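(* Let $\epsilon\in(0,\epsilon^*]$. As $m\to\infty$ the truncated numerical attractor $\mathcal A_m^\epsilon$ is upper semi-convergent to the numerical attractor $\mathcal A^\epsilon$ of the implicit Euler scheme $u_n^\epsilon=u_{n-1}^\epsilon+\epsilon Fu_n^\epsilon$ in $\ell^2$, i.e. $$\lim_{m\to\infty}\mathrm{dist}_{\ell^2}(\mathcal A_m^\epsilon,\mathcal A^\epsilon)=\lim_{m\to\infty}\mathrm{dist}_{\ell^2}(\widetilde{\mathcal A_m^\epsilon},\mathcal A^\epsilon)=0 .$$
   Context: $\ell^2$ is the Hilbert space of real square-summable sequences $u=(u_i)_{i\in\mathbb Z}$ with norm $\|u\|=(\sum_i u_i^2)^{1/2}$; $B_r=\{u\in\ell^2:\|u\|\le r\}$. Parameters: $\alpha,\beta,\nu,\lambda>0$, $\gamma\in(0,1)$, $f\in\ell^2$. $(\Lambda u)_i=-u_{i-1}+2u_i-u_{i+1}$, $(D^-u)_i=u_{i-1}-u_i$. Products are componentwise. $Fu=\nu\Lambda u-\alpha uD^-u+\beta u(1-u)(u-\gamma)-\lambda u+f$. Constants: $\lambda^*=4\nu+\frac{(2\alpha+\beta+\beta\gamma)^2}{4\beta}-\beta\gamma$, with standing assumption $\lambda>\lambda^*$; for $r>0$, $M_r=\beta r^3+(2\alpha+\beta+\beta\gamma)r^2+(4\nu+\beta\gamma+\lambda)r+\|f\|$, $L_r=4\nu+2\sqrt5\,r\alpha+\sqrt{12r^2(1+\gamma)^2+27r^4+3\gamma^2}\,\beta+\lambda$; $r^*=1+\frac{\|f\|}{\lambda-\lambda^*}$;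 $\epsilon^*=\min\left(\frac1{M_{r^*+1}},\frac1{1+L_{r^*+1}}\right)$. $\mathrm{dist}_{\ell^2}(A,B)=\sup_{a\in A}\inf_{b\in B}\|a-b\|$ is the Hausdorff semi-distance. For $\epsilon\in(0,\epsilon^*]$ and $y\in B_{r^*}$ the scheme with $u_0^\epsilon=y$ has a unique solution $u_n^\epsilon(y)\in B_{r^*}$; set $S_\epsilon(n)y=u^\epsilon_n(y)$. $\mathcal A^\epsilon$ is the unique compact set (in $B_{r^*}$) with $S_\epsilon(n)\mathcal A^\epsilon=\mathcal A^\epsilon$ for all $n\in\mathbb N$ and $\lim_{n\to\infty}\mathrm{dist}_{\ell^2}(S_\epsilon(n)B_{r^*},\mathcal A^\epsilon)=0$. Truncation: $\mathbb R^{2m+1}$ has coordinates indexed by $|i|\le m$ and Euclidean norm; $B_r^m$ is its closed ball of radius $r$ about $0$. $D_m^-$ is the matrix with $-1$ on the diagonal, $1$ on the first subdiagonal, $0$ elsewhere (so $(D_m^-z)_{-m}=-z_{-m}$, $(D_m^-z)_i=z_{i-1}-z_i$ for $-m<i\le m$); $\Lambda_m=(D_m^-)^{\top}D_m^-$ is tridiagonal with off-diagonal entries $-1$ and diagonal $2,\dots,2,1$. $f^m=(f_i)_{|i|\le m}$ and $F_mz=\nu\Lambda_mz-\alpha zD_m^-z+\beta z(1-z)(z-\gamma)-\lambda z+f^m$. For $y\in B^m_{r^*}$, $u_n^{\epsilon,m}(y)\in B^m_{r^*}$ is the unique solution of $u_n^{\epsilon,m}=u_{n-1}^{\epsilon,m}+\epsilon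 F_mu_n^{\epsilon,m}$, $u_0^{\epsilon,m}=y$, and $\mathcal A_m^\epsilon=\bigcap_{N\ge1}\overline{\bigcup_{n\ge N}u_n^{\epsilon,m}(B^m_{r^*})}$ is its attractor. The null-expansion of $z\in\mathbb R^{2m+1}$ is $\tilde z\in\ell^2$ with $\tilde z_i=z_i$ for $|i|\le m$ and $\tilde z_i=0$ for $|i|>m$; $\widetilde{\mathcal A_m^\epsilon}=\{\tilde z:z\in\mathcal A_m^\epsilon\}$, and $\mathrm{dist}_{\ell^2}(\mathcal A_m^\epsilon,\cdot)$ is understood via this embedding. *)

theory Defs
  imports "HOL-Analysis.Analysis"
begin

definition square_summable :: "(int \<Rightarrow> real) \<Rightarrow> bool" where
  "square_summable u \<longleftrightarrow> (\<lambda>i. (u i)\<^sup>2) summable_on UNIV"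

lemma square_summable_bound:
  assumes u: "square_summable u" and v: "square_summable v"
    and w: "\<And>i. \<bar>w i\<bar> \<le> C * (\<bar>u i\<bar> + \<bar>v i\<bar>)"
  shows "square_summable w"
proof -
  have s: "(\<lambda>i. 2 * C\<^sup>2 * ((u i)\<^sup>2 + (v i)\<^sup>2)) summable_on UNIV"
    using u v unfolding square_summable_def
    by (intro summable_on_cmult_right summable_on_add)
  have "(\<lambda>i. (w i)\<^sup>2) summable_on UNIV"
  proof (rule summable_on_comparison_test[OF s])
    fix i
    have "(w i)\<^sup>2 \<le> (C * (\<bar>u i\<bar> + \<bar>v i\<bar>))\<^sup>2"
      using power_mono[OF w[of i], of 2] by simp
    also have "\<dots> = C\<^sup>2 * (\<bar>u i\<bar> + \<bar>v i\<bar>)\<^sup>2"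
      by (simp add: power_mult_distrib)
    also have "\<dots> \<le> C\<^sup>2 * (2 * ((u i)\<^sup>2 + (v i)\<^sup>2))"
    proof (rule mult_left_mono)
      have "0 \<le> (\<bar>u i\<bar> - \<bar>v i\<bar>)\<^sup>2" by simp
      then show "(\<bar>u i\<bar> + \<bar>v i\<bar>)\<^sup>2 \<le> 2 * ((u i)\<^sup>2 + (v i)\<^sup>2)"
        by (simp add: power2_sum power2_diff)
    qed simp
    finally show "(w i)\<^sup>2 \<le> 2 * C\<^sup>2 * ((u i)\<^sup>2 + (v i)\<^sup>2)" by (simp only: mult_ac)
  qed auto
  then show ?thesis by (simp add: square_summable_def)
qed

lemma square_summable_bound1:
  assumes "square_summable u" and "\<And>i. \<bar>w i\<bar> \<le> C * \<bar>u i\<bar>"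
  shows "square_summable w"
  by (rule square_summable_bound[OF assms(1) assms(1), of w "C / 2"])
     (use assms(2) in simp)

lemma square_summable_zero: "square_summable (\<lambda>_. 0)"
  by (simp add: square_summable_def)

lemma square_summable_finite_support:
  assumes "finite {i. u i \<noteq> 0}"
  shows "square_summable u"
proof -
  have "(\<lambda>i. (u i)\<^sup>2) summable_on {i. u i \<noteq> 0}"
    using assms by (rule summable_on_finite)
  then show ?thesis
    unfolding square_summable_def by (rule summable_on_cong_neutral[THEN iffD1, rotated -1]) auto
qed

lemma square_summable_shift:
  assumes "square_summable u"
  shows "square_summable (\<lambda>i. u (i + k))"
proof -
  have "bij_betw (\<lambda>i::int. i + k) UNIV UNIV"
    by (rule bij_betwI[where g = "\<lambda>i. i - k"]) auto
  from summable_on_reindex_bij_betw[OF this, of "\<lambda>i. (u i)\<^sup>2"] assms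
  show ?thesis by (simp add: square_summable_def)
qed

lemma square_summable_bounded:
  assumes "square_summable u"
  shows "\<exists>B\<ge>0. \<forall>i. \<bar>u i\<bar> \<le> B"
proof (intro exI conjI allI)
  show "0 \<le> sqrt (\<Sum>\<^sub>\<infinity>i. (u i)\<^sup>2)" by (simp add: infsum_nonneg)
  fix i
  have "(\<Sum>\<^sub>\<infinity>j\<in>{i}. (u j)\<^sup>2) \<le> (\<Sum>\<^sub>\<infinity>j. (u j)\<^sup>2)"
    by (rule infsum_mono_neutral) (use assms in \<open>auto simp: square_summable_def\<close>)
  then have "(u i)\<^sup>2 \<le> (\<Sum>\<^sub>\<infinity>j. (u j)\<^sup>2)" by simp
  then show "\<bar>u i\<bar> \<le> sqrt (\<Sum>\<^sub>\<infinity>i. (u i)\<^sup>2)"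
    using real_sqrt_le_mono by fastforce
qed

lemma square_summable_add:
  "square_summable u \<Longrightarrow> square_summable v \<Longrightarrow> square_summable (\<lambda>i. u i + v i)"
  by (rule square_summable_bound[where u = u and v = v and C = 1]) auto

lemma square_summable_diff:
  "square_summable u \<Longrightarrow> square_summable v \<Longrightarrow> square_summable (\<lambda>i. u i - v i)"
  by (rule square_summable_bound[where u = u and v = v and C = 1]) auto

lemma square_summable_scale: "square_summable u \<Longrightarrow> square_summable (\<lambda>i. c * u i)"
  by (rule square_summable_bound1[where C = "\<bar>c\<bar>"]) (auto simp: abs_mult)

lemma square_summable_mult:
  assumes "square_summable u" and "square_summable v"
  shows "square_summable (\<lambda>i. u i * v i)"
proof -
  obtain B where "\<And>i. \<bar>u i\<bar> \<le> B"
    using square_summable_bounded[OF assms(1)] by blast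
  then show ?thesis
    by (intro square_summable_bound1[OF assms(2), where C = B])
       (auto simp: abs_mult intro: mult_right_mono)
qed

lemma square_summable_cubic:
  assumes "square_summable u"
  shows "square_summable (\<lambda>i. u i * (1 - u i) * (u i - c))"
proof -
  have "square_summable (\<lambda>i. u i * u i)" "square_summable (\<lambda>i. u i * (u i * u i))"
    using assms by (auto intro!: square_summable_mult)
  then have "square_summable (\<lambda>i. ((1 + c) * (u i * u i) - u i * (u i * u i)) - c * u i)"
    using assms by (intro square_summable_diff square_summable_scale)
  moreover have "(\<lambda>i. ((1 + c) * (u i * u i) - u i * (u i * u i)) - c * u i)
      = (\<lambda>i. u i * (1 - u i) * (u i - c))"
    by (auto simp: algebra_simps)
  ultimately show ?thesis by simp
qed

lemma square_summable_inner:
  assumes "square_summable u" and "square_summable v"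
  shows "(\<lambda>i. u i * v i) summable_on UNIV"
proof -
  have "(\<lambda>i. 1/2 * ((u i + v i)\<^sup>2 + (- 1) * ((u i)\<^sup>2 + (v i)\<^sup>2))) summable_on UNIV"
    using square_summable_add[OF assms] assms unfolding square_summable_def
    by (intro summable_on_cmult_right summable_on_add)
  moreover have "(\<lambda>i. 1/2 * ((u i + v i)\<^sup>2 + (- 1) * ((u i)\<^sup>2 + (v i)\<^sup>2))) = (\<lambda>i. u i * v i)"
    by (auto simp: power2_sum)
  ultimately show ?thesis by simp
qed

typedef ell2 = "{u. square_summable u}"
  morphisms ell2_nth Abs_ell2
  using square_summable_zero by blast

setup_lifting type_definition_ell2

lemma square_summable_ell2_nth: "square_summable (ell2_nth u)"
  using ell2_nth by simp

lemma ell2_eqI: "(\<And>i. ell2_nth u i = ell2_nth v i) \<Longrightarrow> u = v"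
  by (simp add: ell2_nth_inject[symmetric] ext)

instantiation ell2 :: real_vector
begin

lift_definition zero_ell2 :: ell2 is "\<lambda>_. 0"
  by (rule square_summable_zero)

lift_definition plus_ell2 :: "ell2 \<Rightarrow> ell2 \<Rightarrow> ell2" is "\<lambda>u v i. u i + v i"
  by (rule square_summable_add)

lift_definition minus_ell2 :: "ell2 \<Rightarrow> ell2 \<Rightarrow> ell2" is "\<lambda>u v i. u i - v i"
  by (rule square_summable_diff)

lift_definition uminus_ell2 :: "ell2 \<Rightarrow> ell2" is "\<lambda>u i. - u i"
  by (simp add: square_summable_def)

lift_definition scaleR_ell2 :: "real \<Rightarrow> ell2 \<Rightarrow> ell2" is "\<lambda>c u i. c * u i"
  by (rule square_summable_scale)

instance
  by standard (transfer; force simp: algebra_simps)+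

end

instantiation ell2 :: real_inner
begin

lift_definition inner_ell2 :: "ell2 \<Rightarrow> ell2 \<Rightarrow> real" is "\<lambda>u v. \<Sum>\<^sub>\<infinity>i. u i * v i" .

lift_definition norm_ell2 :: "ell2 \<Rightarrow> real" is "\<lambda>u. sqrt (\<Sum>\<^sub>\<infinity>i. (u i)\<^sup>2)" .

definition sgn_ell2 :: "ell2 \<Rightarrow> ell2" where
  "sgn_ell2 u = inverse (norm u) *\<^sub>R u"

definition dist_ell2 :: "ell2 \<Rightarrow> ell2 \<Rightarrow> real" where
  "dist_ell2 u v = norm (u - v)"

definition uniformity_ell2 :: "(ell2 \<times> ell2) filter" where
  "uniformity_ell2 = (INF e\<in>{0<..}. principal {(u, v). dist u v < e})"

definition open_ell2 :: "ell2 set \<Rightarrow> bool" where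
  "open_ell2 U \<longleftrightarrow> (\<forall>x\<in>U. eventually (\<lambda>(x', y). x' = x \<longrightarrow> y \<in> U) uniformity)"

instance
proof
  fix u v w :: ell2 and c :: real and U :: "ell2 set"
  show "sgn u = inverse (norm u) *\<^sub>R u" by (rule sgn_ell2_def)
  show "dist u v = norm (u - v)" by (rule dist_ell2_def)
  show "uniformity = (INF e\<in>{0<..}. principal {(u::ell2, v). dist u v < e})"
    by (rule uniformity_ell2_def)
  show "open U \<longleftrightarrow> (\<forall>x\<in>U. eventually (\<lambda>(x', y). x' = x \<longrightarrow> y \<in> U) uniformity)"
    by (rule open_ell2_def)
  show "inner u v = inner v u"
    by transfer (simp add: mult.commute)
  show "inner (u + v) w = inner u w + inner v w"
    by transfer (simp add: distrib_right infsum_add square_summable_inner)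
  show "inner (c *\<^sub>R u) v = c * inner u v"
    by transfer (simp add: mult.assoc infsum_cmult_right')
  show "0 \<le> inner u u"
    by transfer (simp add: infsum_nonneg)
  show "norm u = sqrt (inner u u)"
    by transfer (simp add: power2_eq_square)
  show "inner u u = 0 \<longleftrightarrow> u = 0"
  proof
    assume "inner u u = 0"
    then show "u = 0"
    proof transfer
      fix u :: "int \<Rightarrow> real"
      assume u: "square_summable u" and "(\<Sum>\<^sub>\<infinity>i. u i * u i) = 0"
      then have "u i * u i = 0" for i
        by (intro nonneg_infsum_le_0D[of "\<lambda>i. u i * u i" UNIV])
           (auto intro: square_summable_inner)
      then show "u = (\<lambda>_. 0)" by auto
    qed
  qed (transfer, simp)
qed

end

instantiation ell2 :: times
begin

lift_definition times_ell2 :: "ell2 \<Rightarrow> ell2 \<Rightarrow> ell2" is "\<lambda>u v i. u i * v i"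
  by (rule square_summable_mult)

instance ..

end

lift_definition Lap :: "ell2 \<Rightarrow> ell2" is "\<lambda>u i. - u (i - 1) + 2 * u i - u (i + 1)"
proof -
  fix u assume u: "square_summable u"
  then have "square_summable (\<lambda>i. 2 * u i - u (i + - 1) - u (i + 1))"
    by (intro square_summable_diff square_summable_scale square_summable_shift)
  then show "square_summable (\<lambda>i. - u (i - 1) + 2 * u i - u (i + 1))" by simp
qed

lift_definition Dminus :: "ell2 \<Rightarrow> ell2" is "\<lambda>u i. u (i - 1) - u i"
proof -
  fix u assume u: "square_summable u"
  then have "square_summable (\<lambda>i. u (i + - 1) - u i)"
    by (intro square_summable_diff square_summable_shift)
  then show "square_summable (\<lambda>i. u (i - 1) - u i)" by simp
qed

text \<open>The constant sequences in \<open>u (1 - u) (u - c)\<close> are not square-summable, only the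
  product is; so the cubic is lifted as a whole.\<close>

lift_definition cubic :: "real \<Rightarrow> ell2 \<Rightarrow> ell2" is "\<lambda>c u i. u i * (1 - u i) * (u i - c)"
  by (rule square_summable_cubic)

text \<open>With values in \<^typ>\<open>ennreal\<close>, the infimum over the empty set is \<open>\<infinity>\<close>, so that no
  nonempty set is close to the empty one, and an unbounded supremum is \<open>\<infinity>\<close> as well.\<close>

definition hausdorff_semidist :: "'a::metric_space set \<Rightarrow> 'a set \<Rightarrow> ennreal" where
  "hausdorff_semidist A B = (SUP a\<in>A. INF b\<in>B. ennreal (dist a b))"

text \<open>A vector of \<open>\<real>\<^sup>2\<^sup>m\<^sup>+\<^sup>1\<close> is an (extensional) real function on the index set
  \<open>{-m, \<dots>, m}\<close>.\<close>

definition idx :: "nat \<Rightarrow> int set" where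
  "idx m = {- int m .. int m}"

definition trunc_space :: "nat \<Rightarrow> (int \<Rightarrow> real) set" where
  "trunc_space m = idx m \<rightarrow>\<^sub>E UNIV"

definition trunc_topology :: "nat \<Rightarrow> (int \<Rightarrow> real) topology" where
  "trunc_topology m =
     Metric_space.mtopology (trunc_space m) (\<lambda>z w. L2_set (\<lambda>i. z i - w i) (idx m))"

definition trunc_ball :: "nat \<Rightarrow> real \<Rightarrow> (int \<Rightarrow> real) set" where
  "trunc_ball m r = {z \<in> trunc_space m. L2_set z (idx m) \<le> r}"

definition matvec :: "nat \<Rightarrow> (int \<Rightarrow> int \<Rightarrow> real) \<Rightarrow> (int \<Rightarrow> real) \<Rightarrow> (int \<Rightarrow> real)" where
  "matvec m A z = (\<lambda>i\<in>idx m. \<Sum>j\<in>idx m. A i j * z j)"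

text \<open>The entries of \<open>D\<^sub>m\<^sup>-\<close> do not depend on \<open>m\<close>; only the index range does.\<close>

definition Dminus_mat :: "int \<Rightarrow> int \<Rightarrow> real" where
  "Dminus_mat i j = (if j = i then - 1 else if j = i - 1 then 1 else 0)"

definition Lap_mat :: "nat \<Rightarrow> int \<Rightarrow> int \<Rightarrow> real" where
  "Lap_mat m i j = (\<Sum>k\<in>idx m. Dminus_mat k i * Dminus_mat k j)"

lift_definition null_expansion :: "nat \<Rightarrow> (int \<Rightarrow> real) \<Rightarrow> ell2"
  is "\<lambda>m z i. if i \<in> idx m then z i else 0"
proof -
  fix m :: nat and z :: "int \<Rightarrow> real"
  have "{i. (if i \<in> idx m then z i else 0) \<noteq> 0} \<subseteq> idx m" by auto
  then have "finite {i. (if i \<in> idx m then z i else 0) \<noteq> 0}"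
    by (rule finite_subset) (simp add: idx_def)
  then show "square_summable (\<lambda>i. if i \<in> idx m then z i else 0)"
    by (rule square_summable_finite_support)
qed

locale lattice_system =
  fixes \<alpha> \<beta> \<nu> \<gamma> lam :: real and f :: ell2
begin

definition F :: "ell2 \<Rightarrow> ell2" where
  "F u = \<nu> *\<^sub>R Lap u - \<alpha> *\<^sub>R (u * Dminus u) + \<beta> *\<^sub>R cubic \<gamma> u - lam *\<^sub>R u + f"

definition lam_star :: real where
  "lam_star = 4 * \<nu> + (2 * \<alpha> + \<beta> + \<beta> * \<gamma>)\<^sup>2 / (4 * \<beta>) - \<beta> * \<gamma>"

definition M :: "real \<Rightarrow> real" where
  "M r = \<beta> * r ^ 3 + (2 * \<alpha> + \<beta> + \<beta> * \<gamma>) * r\<^sup>2 + (4 * \<nu> + \<beta> * \<gamma> + lam) * r + norm f"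

definition L :: "real \<Rightarrow> real" where
  "L r = 4 * \<nu> + 2 * sqrt 5 * r * \<alpha>
     + sqrt (12 * r\<^sup>2 * (1 + \<gamma>)\<^sup>2 + 27 * r ^ 4 + 3 * \<gamma>\<^sup>2) * \<beta> + lam"

definition r_star :: real where
  "r_star = 1 + norm f / (lam - lam_star)"

definition eps_star :: real where
  "eps_star = min (1 / M (r_star + 1)) (1 / (1 + L (r_star + 1)))"

definition is_euler_solution :: "real \<Rightarrow> ell2 \<Rightarrow> (nat \<Rightarrow> ell2) \<Rightarrow> bool" where
  "is_euler_solution \<epsilon> y u \<longleftrightarrow>
     u 0 = y \<and> (\<forall>n. u n \<in> cball 0 r_star) \<and> (\<forall>n\<ge>1. u n = u (n - 1) + \<epsilon> *\<^sub>R F (u n))"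

text \<open>The solution operators are meaningful only for initial values in the ball and
  \<open>0 < \<epsilon> \<le> eps_star\<close>, where the solution staying in the ball exists and is unique;
  they are used only there.\<close>

definition S :: "real \<Rightarrow> nat \<Rightarrow> ell2 \<Rightarrow> ell2" where
  "S \<epsilon> n y = (THE u. is_euler_solution \<epsilon> y u) n"

definition is_attractor :: "real \<Rightarrow> ell2 set \<Rightarrow> bool" where
  "is_attractor \<epsilon> A \<longleftrightarrow>
     compact A \<and> A \<subseteq> cball 0 r_star \<and> (\<forall>n. S \<epsilon> n ` A = A) \<and>
     (\<lambda>n. hausdorff_semidist (S \<epsilon> n ` cball 0 r_star) A) \<longlonglongrightarrow> 0"

definition attractor :: "real \<Rightarrow> ell2 set" where
  "attractor \<epsilon> = (THE A. is_attractor \<epsilon> A)"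

definition F_trunc :: "nat \<Rightarrow> (int \<Rightarrow> real) \<Rightarrow> (int \<Rightarrow> real)" where
  "F_trunc m z = (\<lambda>i\<in>idx m.
     \<nu> * matvec m (Lap_mat m) z i - \<alpha> * (z i * matvec m Dminus_mat z i)
     + \<beta> * (z i * (1 - z i) * (z i - \<gamma>)) - lam * z i + ell2_nth f i)"

definition is_euler_solution_trunc ::
    "real \<Rightarrow> nat \<Rightarrow> (int \<Rightarrow> real) \<Rightarrow> (nat \<Rightarrow> int \<Rightarrow> real) \<Rightarrow> bool" where
  "is_euler_solution_trunc \<epsilon> m y u \<longleftrightarrow>
     u 0 = y \<and> (\<forall>n. u n \<in> trunc_ball m r_star) \<and>
     (\<forall>n\<ge>1. \<forall>i\<in>idx m. u n i = u (n - 1) i + \<epsilon> * F_trunc m (u n) i)"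

definition S_trunc :: "real \<Rightarrow> nat \<Rightarrow> nat \<Rightarrow> (int \<Rightarrow> real) \<Rightarrow> (int \<Rightarrow> real)" where
  "S_trunc \<epsilon> m n y = (THE u. is_euler_solution_trunc \<epsilon> m y u) n"

definition attractor_trunc :: "real \<Rightarrow> nat \<Rightarrow> (int \<Rightarrow> real) set" where
  "attractor_trunc \<epsilon> m = (\<Inter>N\<in>{1..}.
     trunc_topology m closure_of (\<Union>n\<in>{N..}. S_trunc \<epsilon> m n ` trunc_ball m r_star))"

end

end

(* Null expansion turns the truncated scheme into the implicit Euler scheme u = y + eps (G I u) in
   l^2, where G I is built from F by restricting to I = {-m..m}, and G UNIV = F.  All G I obey the
   bounds M_r and L_r, and on sequences supported in I the componentwise product u (G I u) is at most
   u (F u), so they are at least as dissipative as F in every weighted norm.  With a cutoff weight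
   this makes the tails of all trajectories small after finitely many steps, uniformly in I.
   For I = UNIV this is the asymptotic compactness that yields the attractor A.  For I = {-m..m} it
   makes the consistency error F - G I, which only sees the entries near the boundary of I
   and the tail of f, small along trajectories; so for fixed n the two schemes stay close for n steps,
   and choosing n with S(n) B close to A gives the claim. *)

theory Submission
  imports Defs
begin

subsection \<open>The space of square-summable sequences\<close>

text \<open>The sign of the discrete Laplacian shapes the estimates:
  \<open>\<nu> *\<^sub>R Lap u\<close> is anti-diffusive, so it supplies no dissipation and is paid
  for by the \<open>4 * \<nu>\<close> in \<open>lam_star\<close>. For the same reason the smaller
  corner entry 1 of the truncated Laplacian can only help: at the right end of the index range it
  removes \<open>\<nu>\<close> times a square from u (F u). Truncated energy estimates can therefore
  be done with \<open>F\<close> on all of Z, where shifted sums cancel without boundary terms. The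
  obstacle is that balls of l^2 are not compact, so the consistency error is not uniformly small on
  \<open>cball 0 r_star\<close>; it is small only after an entry time N from which all tails are
  small. On the other hand the error over n steps is amplified by \<open>step_const ^ n\<close>.
  This forces the order of choice: n from the attraction to \<open>attractor\<close>, then the tail
  size in terms of n, then K and N, and m last. Orbits of length at least N + n near a point of
  \<open>attractor_trunc\<close> come straight from its definition by closures, and the comparison
  covers only their last n steps.\<close>

lemma ell2_nth_simps [simp]:
  "ell2_nth 0 i = 0"
  "ell2_nth (u + v) i = ell2_nth u i + ell2_nth v i"
  "ell2_nth (u - v) i = ell2_nth u i - ell2_nth v i"
  "ell2_nth (- u) i = - ell2_nth u i"
  "ell2_nth (c *\<^sub>R u) i = c * ell2_nth u i"
  "ell2_nth (u * v) i = ell2_nth u i * ell2_nth v i"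
  "ell2_nth (Lap u) i = - ell2_nth u (i - 1) + 2 * ell2_nth u i - ell2_nth u (i + 1)"
  "ell2_nth (Dminus u) i = ell2_nth u (i - 1) - ell2_nth u i"
  "ell2_nth (cubic c u) i = ell2_nth u i * (1 - ell2_nth u i) * (ell2_nth u i - c)"
  "ell2_nth (null_expansion m z) i = (if i \<in> idx m then z i else 0)"
  by (transfer; simp)+

lemma ell2_nth_summable:
  "(\<lambda>i. (ell2_nth u i)\<^sup>2) summable_on UNIV"
  "(\<lambda>i. ell2_nth u i * ell2_nth v i) summable_on UNIV"
  using square_summable_ell2_nth[of u] square_summable_inner[OF square_summable_ell2_nth square_summable_ell2_nth, of u v]
  by (simp_all add: square_summable_def)

lemma norm_ell2_power2: "(norm u)\<^sup>2 = (\<Sum>\<^sub>\<infinity>i. (ell2_nth u i)\<^sup>2)" for u :: ell2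
  by transfer (simp add: infsum_nonneg)

lemma norm_ell2_mono:
  assumes "C \<ge> 0" and "\<And>i. \<bar>ell2_nth w i\<bar> \<le> C * \<bar>ell2_nth u i\<bar>"
  shows "norm w \<le> C * norm u"
proof -
  have "(norm w)\<^sup>2 \<le> (\<Sum>\<^sub>\<infinity>i. C\<^sup>2 * (ell2_nth u i)\<^sup>2)"
    unfolding norm_ell2_power2
  proof (rule infsum_mono)
    fix i show "(ell2_nth w i)\<^sup>2 \<le> C\<^sup>2 * (ell2_nth u i)\<^sup>2"
      using power_mono[OF assms(2)[of i], of 2] by (simp add: power_mult_distrib)
  qed (rule ell2_nth_summable summable_on_cmult_right)+
  also have "\<dots> = (C * norm u)\<^sup>2"
    by (simp add: norm_ell2_power2 infsum_cmult_right' power_mult_distrib)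
  finally show ?thesis
    by (rule power2_le_imp_le) (simp add: assms(1))
qed

lemma finite_sum_le_norm_ell2: "finite J \<Longrightarrow> (\<Sum>i\<in>J. (ell2_nth u i)\<^sup>2) \<le> (norm u)\<^sup>2"
  unfolding norm_ell2_power2 by (rule finite_sum_le_infsum[OF ell2_nth_summable(1)]) auto

lemma abs_ell2_nth_le_norm: "\<bar>ell2_nth u i\<bar> \<le> norm u"
  by (rule power2_le_imp_le) (use finite_sum_le_norm_ell2[of "{i}" u] in simp_all)

lemma norm_ell2_times_le: "norm (u * v) \<le> norm u * norm v" for u v :: ell2
  by (rule norm_ell2_mono) (auto simp: abs_mult intro: mult_right_mono abs_ell2_nth_le_norm)

lemma norm_ell2_leI:
  assumes "C \<ge> 0" and "\<And>J. finite J \<Longrightarrow> (\<Sum>i\<in>J. (ell2_nth u i)\<^sup>2) \<le> C\<^sup>2"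
  shows "norm u \<le> C"
proof -
  have "(norm u)\<^sup>2 \<le> C\<^sup>2"
    unfolding norm_ell2_power2 by (rule infsum_le_finite_sums[OF ell2_nth_summable(1)]) (use assms in auto)
  then show ?thesis using assms(1) by (rule power2_le_imp_le)
qed

text \<open>Cauchy bounds on finite partial sums pass to the coordinatewise limit and are uniform in
  the finite set \<open>J\<close>; so the limit is square-summable and the convergence holds in
  norm.\<close>

instance ell2 :: banach
proof
  fix X :: "nat \<Rightarrow> ell2" assume X: "Cauchy X"
  have "Cauchy (\<lambda>n. ell2_nth (X n) i)" for i
  proof (rule metric_CauchyI)
    fix e :: real assume "e > 0"
    then obtain N where "\<forall>m\<ge>N. \<forall>n\<ge>N. dist (X m) (X n) < e"
      using X unfolding Cauchy_def by blast
    moreover have "dist (ell2_nth (X m) i) (ell2_nth (X n) i) \<le> dist (X m) (X n)" for m n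
      using abs_ell2_nth_le_norm[of "X m - X n" i] by (simp add: dist_norm)
    ultimately show "\<exists>N. \<forall>m\<ge>N. \<forall>n\<ge>N. dist (ell2_nth (X m) i) (ell2_nth (X n) i) < e"
      by (meson le_less_trans)
  qed
  then obtain v where v: "\<And>i. (\<lambda>n. ell2_nth (X n) i) \<longlonglongrightarrow> v i"
    unfolding Cauchy_convergent_iff convergent_def by metis
  have tail: "\<exists>N. \<forall>n\<ge>N. \<forall>J. finite J \<longrightarrow> (\<Sum>i\<in>J. (ell2_nth (X n) i - v i)\<^sup>2) \<le> e\<^sup>2" if "e > 0" for e
  proof -
    obtain N where N: "\<forall>m\<ge>N. \<forall>n\<ge>N. dist (X m) (X n) < e"
      using X \<open>e > 0\<close> unfolding Cauchy_def by blast
    have "(\<Sum>i\<in>J. (ell2_nth (X n) i - v i)\<^sup>2) \<le> e\<^sup>2" if "n \<ge> N" "finite J" for n J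
    proof (rule LIMSEQ_le_const2)
      show "(\<lambda>m. \<Sum>i\<in>J. (ell2_nth (X n) i - ell2_nth (X m) i)\<^sup>2)
          \<longlonglongrightarrow> (\<Sum>i\<in>J. (ell2_nth (X n) i - v i)\<^sup>2)"
        by (intro tendsto_intros v)
      have "(\<Sum>i\<in>J. (ell2_nth (X n) i - ell2_nth (X m) i)\<^sup>2) \<le> e\<^sup>2" if "m \<ge> N" for m
      proof -
        have "(norm (X n - X m))\<^sup>2 \<le> e\<^sup>2"
          using N \<open>n \<ge> N\<close> \<open>m \<ge> N\<close> by (intro power_mono) (auto simp: dist_norm less_imp_le)
        with finite_sum_le_norm_ell2[OF \<open>finite J\<close>, of "X n - X m"] show ?thesis by simp
      qed
      then show "\<exists>M. \<forall>m\<ge>M. (\<Sum>i\<in>J. (ell2_nth (X n) i - ell2_nth (X m) i)\<^sup>2) \<le> e\<^sup>2"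
        by blast
    qed
    then show ?thesis by blast
  qed
  obtain N where N: "\<And>J. finite J \<Longrightarrow> (\<Sum>i\<in>J. (ell2_nth (X N) i - v i)\<^sup>2) \<le> 1"
    using tail[of 1] by auto
  have "square_summable (\<lambda>i. ell2_nth (X N) i - v i)"
    unfolding square_summable_def
    by (rule nonneg_bdd_above_summable_on) (use N in \<open>auto intro!: bdd_aboveI[of _ 1]\<close>)
  from square_summable_diff[OF square_summable_ell2_nth[of "X N"] this]
  have "square_summable v" by simp
  then obtain w where w: "v = ell2_nth w"
    by (metis Abs_ell2_inverse mem_Collect_eq)
  have "X \<longlonglongrightarrow> w"
  proof (rule metric_LIMSEQ_I)
    fix e :: real assume "e > 0"
    then obtain N where "\<forall>n\<ge>N. \<forall>J. finite J \<longrightarrow> (\<Sum>i\<in>J. (ell2_nth (X n) i - v i)\<^sup>2) \<le> (e/2)\<^sup>2"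
      using tail[of "e/2"] by auto
    then have "norm (X n - w) \<le> e / 2" if "n \<ge> N" for n
      using that \<open>e > 0\<close> by (intro norm_ell2_leI) (auto simp: w)
    then show "\<exists>N. \<forall>n\<ge>N. dist (X n) w < e"
      using \<open>e > 0\<close> by (intro exI[of _ N]) (fastforce simp: dist_norm)
  qed
  then show "convergent X" by (auto simp: convergent_def)
qed

section \<open>Shifts, restrictions and one-sided differences\<close>

lift_definition ell2_shift :: "int \<Rightarrow> ell2 \<Rightarrow> ell2" is "\<lambda>k u i. u (i + k)"
  by (rule square_summable_shift)

lift_definition restr :: "int set \<Rightarrow> ell2 \<Rightarrow> ell2" is "\<lambda>I u i. if i \<in> I then u i else 0"
  by (rule square_summable_bound1[where C = 1]) auto

text \<open>The adjoint of \<open>Dminus\<close>; on zero extensions it plays the part of the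
  transpose of \<open>Dminus_mat\<close>.\<close>

definition Dplus :: "ell2 \<Rightarrow> ell2" where
  "Dplus u = ell2_shift 1 u - u"

lemma ell2_shift_nth [simp]: "ell2_nth (ell2_shift k u) i = ell2_nth u (i + k)"
  by transfer simp

lemma restr_nth [simp]: "ell2_nth (restr I u) i = (if i \<in> I then ell2_nth u i else 0)"
  by transfer simp

lemma infsum_shift_int: "(\<Sum>\<^sub>\<infinity>i. g (i + k)) = (\<Sum>\<^sub>\<infinity>i. g i)" for k :: int
proof -
  have "bij_betw (\<lambda>i::int. i + k) UNIV UNIV"
    by (rule bij_betwI[where g = "\<lambda>i. i - k"]) auto
  from infsum_reindex_bij_betw[OF this] show ?thesis .
qed

lemma summable_shift_int:
  fixes k :: int
  assumes "g summable_on UNIV"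
  shows "(\<lambda>i. g (i + k)) summable_on UNIV"
proof -
  have "bij_betw (\<lambda>i::int. i + k) UNIV UNIV"
    by (rule bij_betwI[where g = "\<lambda>i. i - k"]) auto
  from summable_on_reindex_bij_betw[OF this] assms show ?thesis by blast
qed

lemma norm_ell2_shift [simp]: "norm (ell2_shift k u) = norm u"
  by (rule power2_eq_imp_eq)
     (auto simp: norm_ell2_power2 infsum_shift_int[of "\<lambda>i. (ell2_nth u i)\<^sup>2"])

lemma norm_restr_le: "norm (restr I u) \<le> norm u"
  using norm_ell2_mono[of 1 "restr I u" u] by auto

lemma norm_Dminus_le: "norm (Dminus u) \<le> 2 * norm u"
proof -
  have "Dminus u = ell2_shift (- 1) u - u" by (rule ell2_eqI) simp
  then show ?thesis using norm_triangle_ineq4[of "ell2_shift (- 1) u" u] by simp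
qed

lemma norm_Dplus_le: "norm (Dplus u) \<le> 2 * norm u"
  using norm_triangle_ineq4[of "ell2_shift 1 u" u] by (simp add: Dplus_def)

lemma Dplus_nth [simp]: "ell2_nth (Dplus u) i = ell2_nth u (i + 1) - ell2_nth u i"
  by (simp add: Dplus_def)

lemma Lap_eq_Dplus_Dminus: "Lap u = Dplus (Dminus u)"
  by (rule ell2_eqI) simp

lemma restr_UNIV [simp]: "restr UNIV u = u"
  by (rule ell2_eqI) simp

lemma restr_diff: "restr I (u - v) = restr I u - restr I v"
  and restr_add: "restr I (u + v) = restr I u + restr I v"
  and restr_scaleR: "restr I (c *\<^sub>R u) = c *\<^sub>R restr I u"
  by (rule ell2_eqI, simp)+

lemma Dminus_diff: "Dminus (u - v) = Dminus u - Dminus v"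
  and Dplus_diff: "Dplus (u - v) = Dplus u - Dplus v"
  by (rule ell2_eqI, simp)+

section \<open>Tails and finite-dimensional parts\<close>

lemma finite_idx [simp]: "finite (idx m)"
  by (simp add: idx_def)

lemma idx_mono: "k \<le> m \<Longrightarrow> idx k \<subseteq> idx m"
  by (auto simp: idx_def)

lemma norm_diff_restr_antimono: "I \<subseteq> J \<Longrightarrow> norm (u - restr J u) \<le> norm (u - restr I u)"
  by (rule order_trans[OF norm_ell2_mono[of 1 _ "u - restr I u"]]) auto

lemma tendsto_norm_diff_restr: "(\<lambda>m. norm (u - restr (idx m) u)) \<longlonglongrightarrow> 0"
proof (rule metric_LIMSEQ_I)
  fix e :: real assume e: "e > 0"
  obtain J where J: "finite J" "dist (\<Sum>i\<in>J. (ell2_nth u i)\<^sup>2) ((norm u)\<^sup>2) \<le> (e/2)\<^sup>2"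
    using infsum_finite_approximation[OF ell2_nth_summable(1), of "(e/2)\<^sup>2" u] e
    by (auto simp: norm_ell2_power2)
  \<comment> \<open>\<open>insert 0\<close> covers an empty \<open>J\<close>.\<close>
  define K where "K = nat (Max (insert 0 (abs ` J)))"
  have JK: "J \<subseteq> idx K"
  proof
    fix i assume "i \<in> J"
    then have "\<bar>i\<bar> \<le> Max (insert 0 (abs ` J))" using J(1) by simp
    then show "i \<in> idx K" by (auto simp: idx_def K_def)
  qed
  have "norm (u - restr (idx m) u) < e" if "m \<ge> K" for m
  proof -
    have "norm (u - restr J u) \<le> e / 2"
    proof (rule norm_ell2_leI)
      fix J' :: "int set" assume J': "finite J'"
      have "(\<Sum>i\<in>J'. (ell2_nth (u - restr J u) i)\<^sup>2) = (\<Sum>i\<in>J' - J. (ell2_nth u i)\<^sup>2)"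
        using J' by (intro sum.mono_neutral_cong_right) auto
      also have "\<dots> = (\<Sum>i\<in>J' \<union> J. (ell2_nth u i)\<^sup>2) - (\<Sum>i\<in>J. (ell2_nth u i)\<^sup>2)"
        using J' J(1) sum.subset_diff[of J "J' \<union> J" "\<lambda>i. (ell2_nth u i)\<^sup>2"] by (simp add: Un_Diff)
      also have "\<dots> \<le> (e/2)\<^sup>2"
        using J J' finite_sum_le_norm_ell2[of "J' \<union> J" u] by (auto simp: dist_norm)
      finally show "(\<Sum>i\<in>J'. (ell2_nth (u - restr J u) i)\<^sup>2) \<le> (e/2)\<^sup>2" .
    qed (use e in simp)
    moreover have "norm (u - restr (idx m) u) \<le> norm (u - restr J u)"
      by (rule norm_diff_restr_antimono) (use JK idx_mono[OF that] in blast)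
    ultimately show ?thesis using e by linarith
  qed
  then show "\<exists>K. \<forall>m\<ge>K. dist (norm (u - restr (idx m) u)) 0 < e" by auto
qed

text \<open>The finite-dimensional half of asymptotic compactness. Each new coordinate adds a
  bounded segment along a unit vector, and the sum of two compact sets is compact.\<close>

lemma restr_image_subset_compact:
  assumes "finite I"
  shows "\<exists>C. compact C \<and> restr I ` cball 0 r \<subseteq> C"
  using assms
proof induction
  case empty
  have "restr {} u = 0" for u by (rule ell2_eqI) simp
  then show ?case by (intro exI[of _ "{0}"]) auto
next
  case (insert j I)
  then obtain C where C: "compact C" "restr I ` cball 0 r \<subseteq> C" by blast
  define e where "e = null_expansion (nat \<bar>j\<bar>) (\<lambda>i. if i = j then 1 else 0)"
  have e_nth: "ell2_nth e i = (if i = j then 1 else 0)" for i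
    by (auto simp: e_def idx_def)
  have "compact ((\<lambda>c. c *\<^sub>R e) ` {-r..r})"
    by (intro compact_continuous_image continuous_intros) auto
  from compact_sums[OF C(1) this]
  have "compact {x + y |x y. x \<in> C \<and> y \<in> (\<lambda>c. c *\<^sub>R e) ` {-r..r}}" .
  moreover have "restr (insert j I) ` cball 0 r
      \<subseteq> {x + y |x y. x \<in> C \<and> y \<in> (\<lambda>c. c *\<^sub>R e) ` {-r..r}}"
  proof clarify
    fix u :: ell2 assume u: "u \<in> cball 0 r"
    have "restr (insert j I) u = restr I u + ell2_nth u j *\<^sub>R e"
      by (rule ell2_eqI) (use insert.hyps in \<open>auto simp: e_nth\<close>)
    moreover have "ell2_nth u j \<in> {-r..r}"
      using u abs_ell2_nth_le_norm[of u j] by auto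
    ultimately show "\<exists>x y. restr (insert j I) u = x + y \<and> x \<in> C \<and> y \<in> (\<lambda>c. c *\<^sub>R e) ` {-r..r}"
      using C(2) u by blast
  qed
  ultimately show ?case by blast
qed

subsection \<open>Attractors of asymptotically compact maps\<close>

lemma hausdorff_semidist_le:
  assumes "\<And>a. a \<in> A \<Longrightarrow> \<exists>b\<in>B. dist a b \<le> e"
  shows "hausdorff_semidist A B \<le> ennreal e"
  unfolding hausdorff_semidist_def
proof (rule SUP_least)
  fix a assume "a \<in> A"
  then obtain b where "b \<in> B" "dist a b \<le> e" using assms by blast
  then show "(INF b\<in>B. ennreal (dist a b)) \<le> ennreal e"
    by (meson INF_lower2 ennreal_leI)
qed

lemma hausdorff_semidist_lessD:
  assumes "hausdorff_semidist A B < ennreal e" and "a \<in> A"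
  shows "\<exists>b\<in>B. dist a b < e"
proof -
  have "(INF b\<in>B. ennreal (dist a b)) < ennreal e"
    using assms unfolding hausdorff_semidist_def by (meson SUP_upper le_less_trans)
  then obtain b where "b \<in> B" "ennreal (dist a b) < ennreal e"
    by (auto simp: INF_less_iff)
  then show ?thesis by (auto simp: ennreal_less_iff)
qed

lemma tendsto_hausdorff_semidist_zeroI:
  assumes "\<And>e. e > 0 \<Longrightarrow> \<forall>\<^sub>F n in F. \<forall>a\<in>A n. \<exists>b\<in>B. dist a b \<le> e"
  shows "((\<lambda>n. hausdorff_semidist (A n) B) \<longlongrightarrow> 0) F"
proof (rule order_tendstoI)
  fix a :: ennreal assume "0 < a"
  \<comment> \<open>\<open>a\<close> may be infinite; a finite positive level below it gives a real
    radius.\<close>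
  then obtain b where b: "0 < b" "b < a" using dense by blast
  then obtain e where e: "b = ennreal e" "e > 0"
    by (cases b) (auto simp: ennreal_less_iff)
  show "\<forall>\<^sub>F n in F. hausdorff_semidist (A n) B < a"
    using assms[OF e(2)]
  proof eventually_elim
    case (elim n)
    then have "hausdorff_semidist (A n) B \<le> b"
      unfolding e(1) by (intro hausdorff_semidist_le) blast
    then show ?case using b(2) by simp
  qed
qed simp

lemma funpow_image_decseq:
  assumes "T ` B \<subseteq> B" and "m \<le> n"
  shows "(T ^^ n) ` B \<subseteq> (T ^^ m) ` B"
proof -
  have "(T ^^ k) ` B \<subseteq> B" for k
    by (induction k) (use assms(1) in auto)
  then have "(T ^^ m) ` ((T ^^ (n - m)) ` B) \<subseteq> (T ^^ m) ` B" by blast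
  moreover have "T ^^ n = T ^^ m \<circ> T ^^ (n - m)"
    using assms(2) by (simp flip: funpow_add)
  ultimately show ?thesis by (metis image_comp)
qed

text \<open>The last hypothesis is asymptotic compactness: for each radius some late image of
  \<open>B\<close> has a finite net, while \<open>B\<close> itself need not have one. The attractor
  is the intersection of the closed images.\<close>

lemma attractor_exists:
  fixes T :: "'a::complete_space \<Rightarrow> 'a"
  assumes B: "closed B" "T ` B \<subseteq> B" and cont: "continuous_on B T"
    and cover: "\<And>e. e > 0 \<Longrightarrow> \<exists>n k. finite k \<and> (T ^^ n) ` B \<subseteq> (\<Union>x\<in>k. ball x e)"
  shows "\<exists>A. compact A \<and> A \<subseteq> B \<and> (\<forall>n. (T ^^ n) ` A = A) \<and>
           (\<lambda>n. hausdorff_semidist ((T ^^ n) ` B) A) \<longlonglongrightarrow> 0"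
proof -
  define A where "A = (\<Inter>n. closure ((T ^^ n) ` B))"
  have TnB: "(T ^^ n) ` B \<subseteq> B" for n
    using funpow_image_decseq[OF B(2), of 0 n] by simp
  have AB: "A \<subseteq> B"
    unfolding A_def using B(1) by (auto dest: INT_D[of _ _ _ 0])
  \<comment> \<open>Only finitely many terms of such a sequence lie outside a given image, so its
    range is totally bounded; since the images decrease, limits of subsequences lie in all closures.
    This serves both the backward invariance and the attraction.\<close>
  have conv: "\<exists>l\<in>A. \<exists>r. strict_mono r \<and> (x \<circ> r) \<longlonglongrightarrow> l"
    if x: "\<And>j. x j \<in> (T ^^ j) ` B" for x
  proof -
    have "\<exists>k. finite k \<and> closure (range x) \<subseteq> (\<Union>y\<in>k. ball y e)" if e: "e > 0" for e
    proof -
      obtain n k where k: "finite k" "(T ^^ n) ` B \<subseteq> (\<Union>y\<in>k. ball y (e/2))"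
        using cover[of "e/2"] e by auto
      have "range x \<subseteq> (\<Union>y\<in>k \<union> x ` {..<n}. cball y (e/2))"
      proof clarify
        fix j
        show "x j \<in> (\<Union>y\<in>k \<union> x ` {..<n}. cball y (e/2))"
        proof (cases "j < n")
          case True then show ?thesis using e by (intro UN_I[of "x j"]) auto
        next
          case False
          then have "x j \<in> (T ^^ n) ` B"
            using x[of j] funpow_image_decseq[OF B(2), of n j] by auto
          then obtain y where "y \<in> k" "x j \<in> ball y (e/2)" using k(2) by blast
          then show ?thesis by (intro UN_I[of y]) auto
        qed
      qed
      moreover have "closed (\<Union>y\<in>k \<union> x ` {..<n}. cball y (e/2))"
        using k(1) by (intro closed_UN) auto
      ultimately have "closure (range x) \<subseteq> (\<Union>y\<in>k \<union> x ` {..<n}. cball y (e/2))"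
        by (rule closure_minimal)
      moreover have "cball y (e/2) \<subseteq> ball y e" for y :: 'a using e by auto
      ultimately have "closure (range x) \<subseteq> (\<Union>y\<in>k \<union> x ` {..<n}. ball y e)" by blast
      then show ?thesis using k(1) by (intro exI[of _ "k \<union> x ` {..<n}"]) auto
    qed
    then have "compact (closure (range x))"
      unfolding compact_eq_totally_bounded by (auto simp: complete_eq_closed)
    then have "seq_compact (closure (range x))" by (simp add: compact_eq_seq_compact_metric)
    then obtain l r where l: "strict_mono r" "(x \<circ> r) \<longlonglongrightarrow> l"
      using closure_subset[of "range x"] by (metis seq_compactE range_subsetD)
    have "l \<in> closure ((T ^^ n) ` B)" for n
    proof (rule closed_sequentially[OF closed_closure])
      show "(\<lambda>j. (x \<circ> r) (j + n)) \<longlonglongrightarrow> l" by (rule LIMSEQ_ignore_initial_segment[OF l(2)])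
      fix j
      have "n \<le> r (j + n)" using seq_suble[OF l(1), of "j + n"] by linarith
      then have "x (r (j + n)) \<in> (T ^^ n) ` B"
        using x funpow_image_decseq[OF B(2)] by blast
      then show "(x \<circ> r) (j + n) \<in> closure ((T ^^ n) ` B)"
        using closure_subset by fastforce
    qed
    then show ?thesis using l by (auto simp: A_def)
  qed
  have "compact A"
    unfolding compact_eq_totally_bounded
  proof (intro conjI allI impI)
    show "complete A" by (auto simp: complete_eq_closed A_def)
    fix e :: real assume e: "e > 0"
    obtain n k where k: "finite k" "(T ^^ n) ` B \<subseteq> (\<Union>y\<in>k. ball y (e/2))"
      using cover[of "e/2"] e by auto
    have "closed (\<Union>y\<in>k. cball y (e/2))" using k(1) by (intro closed_UN) auto
    moreover have "(T ^^ n) ` B \<subseteq> (\<Union>y\<in>k. cball y (e/2))"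
      using k(2) ball_subset_cball by blast
    ultimately have "closure ((T ^^ n) ` B) \<subseteq> (\<Union>y\<in>k. cball y (e/2))"
      by (metis closure_minimal)
    moreover have "cball y (e/2) \<subseteq> ball y e" for y :: 'a using e by auto
    ultimately have "A \<subseteq> (\<Union>y\<in>k. ball y e)" unfolding A_def by blast
    then show "\<exists>k. finite k \<and> A \<subseteq> (\<Union>x\<in>k. ball x e)" using k(1) by blast
  qed
  have inv: "T ` A = A"
  proof
    show "T ` A \<subseteq> A"
    proof clarify
      fix a assume a: "a \<in> A"
      have "T a \<in> closure ((T ^^ n) ` B)" for n
      proof -
        have clB: "closure ((T ^^ n) ` B) \<subseteq> B" using TnB B(1) by (simp add: closure_minimal)
        have "T ` closure ((T ^^ n) ` B) \<subseteq> closure (T ` (T ^^ n) ` B)"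
          by (rule continuous_image_closure_subset[OF cont clB])
        then have "T a \<in> closure ((T ^^ Suc n) ` B)"
          using a by (auto simp: A_def image_comp)
        then show ?thesis
          using closure_mono[OF funpow_image_decseq[OF B(2), of n "Suc n"]] by auto
      qed
      then show "T a \<in> A" by (simp add: A_def)
    qed
    show "A \<subseteq> T ` A"
    proof
      fix a assume a: "a \<in> A"
      \<comment> \<open>Approximate preimages of \<open>a\<close> are taken from later and later
        images, so that \<open>conv\<close> yields a limit in \<open>A\<close>; continuity makes
        this limit an exact preimage.\<close>
      have "\<exists>y. y \<in> (T ^^ j) ` B \<and> dist (T y) a < inverse (real (Suc j))" for j
      proof -
        have "a \<in> closure (T ` (T ^^ j) ` B)"
          using a unfolding A_def by (metis (no_types, lifting) INT_E UNIV_I funpow.simps(2) image_comp)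
        then obtain z where "z \<in> T ` (T ^^ j) ` B" "dist z a < inverse (real (Suc j))"
          unfolding closure_approachable by (metis inverse_Suc)
        then show ?thesis by blast
      qed
      then obtain y where y: "\<And>j. y j \<in> (T ^^ j) ` B" "\<And>j. dist (T (y j)) a < inverse (real (Suc j))"
        by metis
      from conv[OF y(1)] obtain l r where l: "l \<in> A" "strict_mono r" "(y \<circ> r) \<longlonglongrightarrow> l" by blast
      have "(\<lambda>j. T ((y \<circ> r) j)) \<longlonglongrightarrow> T l"
        using l(1) AB subsetD[OF TnB y(1)]
        by (intro continuous_on_tendsto_compose[OF cont l(3)]) (auto intro!: always_eventually)
      moreover have "(\<lambda>j. T (y j)) \<longlonglongrightarrow> a"
      proof (rule tendstoI)
        fix e :: real assume "e > 0"
        then have "\<forall>\<^sub>F j in sequentially. inverse (real (Suc j)) < e"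
          using LIMSEQ_inverse_real_of_nat order_tendstoD(2) by blast
        then show "\<forall>\<^sub>F j in sequentially. dist (T (y j)) a < e"
          by eventually_elim (use y(2) less_trans in blast)
      qed
      from LIMSEQ_subseq_LIMSEQ[OF this l(2)] have "(\<lambda>j. T ((y \<circ> r) j)) \<longlonglongrightarrow> a" by (simp add: o_def)
      ultimately show "a \<in> T ` A" using l(1) LIMSEQ_unique by blast
    qed
  qed
  have inv_n: "(T ^^ n) ` A = A" for n
  proof (induction n)
    case (Suc n)
    have "(T ^^ Suc n) ` A = T ` (T ^^ n) ` A" by (simp add: image_comp)
    with Suc inv show ?case by simp
  qed simp
  have "(\<lambda>n. hausdorff_semidist ((T ^^ n) ` B) A) \<longlonglongrightarrow> 0"
  proof (rule tendsto_hausdorff_semidist_zeroI, rule ccontr)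
    fix e :: real assume e: "e > 0"
    assume "\<not> (\<forall>\<^sub>F n in sequentially. \<forall>a\<in>(T ^^ n) ` B. \<exists>b\<in>A. dist a b \<le> e)"
    then have "\<exists>n\<ge>j. \<exists>a\<in>(T ^^ n) ` B. \<forall>b\<in>A. dist a b > e" for j
      unfolding eventually_sequentially by (meson not_le)
    \<comment> \<open>As the images decrease, a bad point of a later image is also one of the j-th
      image.\<close>
    then have "\<exists>a\<in>(T ^^ j) ` B. \<forall>b\<in>A. dist a b > e" for j
      using funpow_image_decseq[OF B(2), of j] by blast
    then obtain x where x: "\<And>j. x j \<in> (T ^^ j) ` B" "\<And>j b. b \<in> A \<Longrightarrow> dist (x j) b > e"
      by metis
    from conv[OF x(1)] obtain l r where l: "l \<in> A" "(x \<circ> r) \<longlonglongrightarrow> l" by blast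
    then obtain j where "dist ((x \<circ> r) j) l < e" using metric_LIMSEQ_D[OF l(2) e] by blast
    with x(2)[OF l(1), of "r j"] show False by simp
  qed
  with \<open>compact A\<close> AB inv_n show ?thesis by blast
qed

text \<open>An invariant subset of \<open>B\<close> lies in every image of \<open>B\<close>, so
  attraction pushes it into the closed set \<open>A'\<close>. Applied in both directions this gives
  uniqueness of the attractor.\<close>

lemma attractor_unique_subset:
  assumes "\<And>n. U n ` A = A" and "A \<subseteq> B" and "closed A'"
    and "(\<lambda>n. hausdorff_semidist (U n ` B) A') \<longlonglongrightarrow> 0"
  shows "A \<subseteq> A'"
proof
  fix a assume a: "a \<in> A"
  have "\<exists>b\<in>A'. dist b a < e" if "e > 0" for e
  proof -
    have "\<forall>\<^sub>F n in sequentially. hausdorff_semidist (U n ` B) A' < ennreal e"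
      using order_tendstoD(2)[OF assms(4), of "ennreal e"] that by simp
    then obtain n where "hausdorff_semidist (U n ` B) A' < ennreal e"
      by (auto simp: eventually_sequentially)
    moreover have "a \<in> U n ` B" using a assms(1,2) by blast
    ultimately show ?thesis using hausdorff_semidist_lessD by (metis dist_commute)
  qed
  then show "a \<in> A'" using closed_approachable[OF assms(3)] by blast
qed

subsection \<open>The truncated vector fields\<close>

text \<open>The difference quotient is bounded by the three terms \<open>3 * r\<^sup>2\<close>,
  \<open>2 * (1 + c) * r\<close> and \<open>c\<close>; then (x + y + z)^2 <= 3 (x^2 + y^2 + z^2)
  produces the square root that occurs in \<open>L\<close>.\<close>

lemma cubic_lipschitz:
  fixes a b c r :: real
  assumes "\<bar>a\<bar> \<le> r" and "\<bar>b\<bar> \<le> r" and "0 \<le> c"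
  shows "\<bar>a * (1 - a) * (a - c) - b * (1 - b) * (b - c)\<bar>
           \<le> sqrt (12 * r\<^sup>2 * (1 + c)\<^sup>2 + 27 * r ^ 4 + 3 * c\<^sup>2) * \<bar>a - b\<bar>"
proof -
  have r: "0 \<le> r" using assms(1) by linarith
  let ?k = "3 * r\<^sup>2 + 2 * (1 + c) * r + c"
  have "a * (1 - a) * (a - c) - b * (1 - b) * (b - c)
      = (- (a\<^sup>2 + a * b + b\<^sup>2) + (1 + c) * (a + b) - c) * (a - b)"
    by (simp add: algebra_simps power2_eq_square)
  moreover have "\<bar>- (a\<^sup>2 + a * b + b\<^sup>2) + (1 + c) * (a + b) - c\<bar> \<le> ?k"
  proof -
    have "\<bar>a\<^sup>2\<bar> \<le> r\<^sup>2" "\<bar>b\<^sup>2\<bar> \<le> r\<^sup>2"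
      using assms(1,2) power_mono[of "\<bar>a\<bar>" r 2] power_mono[of "\<bar>b\<bar>" r 2] by auto
    moreover have "\<bar>a * b\<bar> \<le> r\<^sup>2"
      unfolding abs_mult power2_eq_square using assms by (intro mult_mono) auto
    moreover have "\<bar>(1 + c) * (a + b)\<bar> \<le> (1 + c) * (2 * r)"
      unfolding abs_mult using assms by (intro mult_mono) auto
    moreover have "(1 + c) * (2 * r) = 2 * (1 + c) * r" by simp
    ultimately show ?thesis using assms(3) unfolding abs_le_iff by linarith
  qed
  moreover have "?k \<le> sqrt (12 * r\<^sup>2 * (1 + c)\<^sup>2 + 27 * r ^ 4 + 3 * c\<^sup>2)"
  proof (rule real_le_rsqrt)
    have "0 \<le> (3 * r\<^sup>2 - 2 * (1 + c) * r)\<^sup>2 + (3 * r\<^sup>2 - c)\<^sup>2 + (2 * (1 + c) * r - c)\<^sup>2"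
      by simp
    also have "\<dots> = 12 * r\<^sup>2 * (1 + c)\<^sup>2 + 27 * r ^ 4 + 3 * c\<^sup>2 - ?k\<^sup>2"
      by (simp add: algebra_simps power2_eq_square power4_eq_xxxx)
    finally show "?k\<^sup>2 \<le> 12 * r\<^sup>2 * (1 + c)\<^sup>2 + 27 * r ^ 4 + 3 * c\<^sup>2" by simp
  qed
  ultimately show ?thesis
    by (simp add: abs_mult mult_right_mono)
qed

text \<open>Young's inequality with exponents 3/2 and 3; it decouples neighbouring sites in the
  transport term.\<close>

lemma young_cubic:
  fixes a b :: real
  assumes "0 \<le> a" and "0 \<le> b"
  shows "a\<^sup>2 * b \<le> (2 * a ^ 3 + b ^ 3) / 3"
proof -
  have "0 \<le> (a - b)\<^sup>2 * (2 * a + b)" using assms by simp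
  also have "\<dots> = 2 * a ^ 3 + b ^ 3 - 3 * (a\<^sup>2 * b)"
    by (simp add: algebra_simps power2_eq_square power3_eq_cube)
  finally show ?thesis by simp
qed

context lattice_system
begin

text \<open>For \<open>I = idx m\<close> the \<open>restr I\<close> around \<open>Dminus\<close>
  deletes the difference just to the right of the range, which turns \<open>Dplus (Dminus u)\<close>
  into the product D^T D of truncated matrices with its corner entry 1. Being defined on all of l^2,
  \<open>G I\<close> admits a fixed point argument in a full ball.\<close>

definition G :: "int set \<Rightarrow> ell2 \<Rightarrow> ell2" where
  "G I u = \<nu> *\<^sub>R restr I (Dplus (restr I (Dminus (restr I u))))
     - \<alpha> *\<^sub>R restr I (restr I u * Dminus (restr I u))
     + \<beta> *\<^sub>R cubic \<gamma> (restr I u) - lam *\<^sub>R restr I u + restr I f"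

lemma G_UNIV: "G UNIV = F"
  by (rule ext) (simp add: G_def F_def Lap_eq_Dplus_Dminus)

lemma restr_G [simp]: "restr I (G I u) = G I u"
  by (rule ell2_eqI) (simp add: G_def)

end

text \<open>Each one-sided difference has norm at most 2 and restrictions do not increase norms;
  hence the \<open>4 * \<nu>\<close> in \<open>M\<close> and \<open>L\<close>.\<close>

lemma norm_restr_Lap_le: "norm (restr I (Dplus (restr I (Dminus (restr I u))))) \<le> 4 * norm u"
proof -
  have "norm (restr I (Dplus (restr I (Dminus (restr I u)))))
      \<le> 2 * (2 * norm (restr I u))"
    by (meson norm_restr_le norm_Dplus_le norm_Dminus_le order_trans mult_left_mono zero_le_numeral)
  then show ?thesis using norm_restr_le[of I u] by simp
qed

locale dissipative_lattice = lattice_system +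
  assumes \<alpha>_pos: "\<alpha> > 0" and \<beta>_pos: "\<beta> > 0" and \<nu>_pos: "\<nu> > 0" and lam_pos: "lam > 0"
    and \<gamma>_pos: "0 < \<gamma>" and lam_gt: "lam > lam_star"
begin

definition \<delta> :: real where "\<delta> = lam - lam_star"

lemma \<delta>_pos: "\<delta> > 0"
  using lam_gt by (simp add: \<delta>_def)

lemma norm_G_le:
  assumes "norm u \<le> r"
  shows "norm (G I u) \<le> M r"
proof -
  define w where "w = restr I u"
  have w: "norm w \<le> r" using norm_restr_le[of I u] assms by (simp add: w_def)
  have r: "0 \<le> r" using assms norm_ge_zero order_trans by blast
  have 1: "norm (restr I (Dplus (restr I (Dminus w)))) \<le> 4 * r"
    using norm_restr_Lap_le[of I u] assms by (simp add: w_def)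
  have ww: "norm (w * w) \<le> r\<^sup>2"
    using norm_ell2_times_le[of w w] mult_mono[OF w w r] by (simp add: power2_eq_square)
  have "norm (w * Dminus w) \<le> r * (2 * r)"
    using norm_ell2_times_le[of w "Dminus w"] norm_Dminus_le[of w] w r
    by (meson mult_mono norm_ge_zero order_trans mult_left_mono zero_le_numeral)
  then have 2: "norm (restr I (w * Dminus w)) \<le> 2 * r\<^sup>2"
    using norm_restr_le[of I "w * Dminus w"] by (simp add: power2_eq_square)
  have "cubic \<gamma> w = (1 + \<gamma>) *\<^sub>R (w * w) - w * (w * w) - \<gamma> *\<^sub>R w"
    by (rule ell2_eqI) (simp add: algebra_simps)
  also have "norm \<dots> \<le> norm ((1 + \<gamma>) *\<^sub>R (w * w)) + norm (w * (w * w)) + norm (\<gamma> *\<^sub>R w)"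
    by (meson add_mono_thms_linordered_semiring(3) norm_triangle_ineq4 order_trans)
  also have "\<dots> \<le> (1 + \<gamma>) * r\<^sup>2 + r ^ 3 + \<gamma> * r"
  proof (intro add_mono)
    show "norm (w * (w * w)) \<le> r ^ 3"
      using norm_ell2_times_le[of w "w * w"] mult_mono[OF w ww r]
      by (simp add: power2_eq_square power3_eq_cube mult.assoc)
  qed (use w ww \<gamma>_pos in auto)
  finally have 3: "norm (cubic \<gamma> w) \<le> (1 + \<gamma>) * r\<^sup>2 + r ^ 3 + \<gamma> * r" .
  have "norm (G I u) \<le> norm (\<nu> *\<^sub>R restr I (Dplus (restr I (Dminus w))))
     + norm (\<alpha> *\<^sub>R restr I (w * Dminus w)) + norm (\<beta> *\<^sub>R cubic \<gamma> w) + norm (lam *\<^sub>R w)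
     + norm (restr I f)"
    unfolding G_def w_def[symmetric]
    by (meson add_mono norm_triangle_ineq norm_triangle_ineq4 order_trans order_refl)
  also have "\<dots> \<le> \<nu> * (4 * r) + \<alpha> * (2 * r\<^sup>2) + \<beta> * ((1 + \<gamma>) * r\<^sup>2 + r ^ 3 + \<gamma> * r) + lam * r + norm f"
    using 1 2 3 w norm_restr_le[of I f] \<alpha>_pos \<beta>_pos \<nu>_pos lam_pos by (intro add_mono) auto
  also have "\<dots> = M r"
    by (simp add: M_def algebra_simps)
  finally show ?thesis .
qed

lemma norm_G_diff_le:
  assumes "norm u \<le> r" and "norm v \<le> r"
  shows "norm (G I u - G I v) \<le> L r * norm (u - v)"
proof -
  define a b where "a = restr I u" and "b = restr I v"
  have a: "norm a \<le> r" "norm b \<le> r" and ab: "norm (a - b) \<le> norm (u - v)"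
    using norm_restr_le[of I u] norm_restr_le[of I v] norm_restr_le[of I "u - v"] assms
    by (auto simp: a_def b_def restr_diff)
  have r: "0 \<le> r" using assms(1) norm_ge_zero order_trans by blast
  define k where "k = sqrt (12 * r\<^sup>2 * (1 + \<gamma>)\<^sup>2 + 27 * r ^ 4 + 3 * \<gamma>\<^sup>2)"
  let ?d = "norm (u - v)"
  let ?Lap = "\<lambda>u. restr I (Dplus (restr I (Dminus (restr I u))))"
  have 1: "norm (?Lap (u - v)) \<le> 4 * ?d"
    by (rule norm_restr_Lap_le)
  have "a * Dminus a - b * Dminus b = a * Dminus (a - b) + (a - b) * Dminus b"
    by (rule ell2_eqI) (simp add: algebra_simps)
  also have "norm \<dots> \<le> norm a * (2 * norm (a - b)) + norm (a - b) * (2 * norm b)"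
    by (meson add_mono mult_left_mono norm_Dminus_le norm_ell2_times_le norm_ge_zero
        norm_triangle_ineq order_trans)
  also have "\<dots> \<le> r * (2 * ?d) + ?d * (2 * r)"
    using a ab r by (intro add_mono mult_mono) auto
  \<comment> \<open>The product rule gives the factor 4, which the \<open>2 * sqrt 5\<close> of
    \<open>L\<close> covers.\<close>
  also have "\<dots> \<le> 2 * sqrt 5 * r * ?d"
  proof -
    have "2 \<le> sqrt 5" by (rule real_le_rsqrt) simp
    then have "2 * (2 * (r * ?d)) \<le> 2 * (sqrt 5 * (r * ?d))"
      using r by (intro mult_left_mono mult_right_mono) auto
    then show ?thesis by (simp add: mult_ac)
  qed
  finally have 2: "norm (restr I (a * Dminus a - b * Dminus b)) \<le> 2 * sqrt 5 * r * ?d"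
    using norm_restr_le order_trans by blast
  have "0 \<le> k" by (simp add: k_def)
  moreover have "norm (cubic \<gamma> a - cubic \<gamma> b) \<le> k * norm (a - b)"
    unfolding k_def
  proof (rule norm_ell2_mono)
    fix i
    have "\<bar>ell2_nth a i\<bar> \<le> r" "\<bar>ell2_nth b i\<bar> \<le> r"
      using a abs_ell2_nth_le_norm order_trans by blast+
    from cubic_lipschitz[OF this, of \<gamma>] \<gamma>_pos
    show "\<bar>ell2_nth (cubic \<gamma> a - cubic \<gamma> b) i\<bar>
      \<le> sqrt (12 * r\<^sup>2 * (1 + \<gamma>)\<^sup>2 + 27 * r ^ 4 + 3 * \<gamma>\<^sup>2) * \<bar>ell2_nth (a - b) i\<bar>" by simp
  qed (auto simp: r)
  ultimately have 3: "norm (cubic \<gamma> a - cubic \<gamma> b) \<le> k * ?d"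
    using ab by (meson mult_left_mono order_trans)
  have "G I u - G I v = \<nu> *\<^sub>R ?Lap (u - v) - \<alpha> *\<^sub>R restr I (a * Dminus a - b * Dminus b)
      + \<beta> *\<^sub>R (cubic \<gamma> a - cubic \<gamma> b) - lam *\<^sub>R (a - b)"
    unfolding G_def a_def[symmetric] b_def[symmetric]
    by (simp add: restr_diff Dminus_diff Dplus_diff a_def b_def algebra_simps)
  also have "norm \<dots> \<le> norm (\<nu> *\<^sub>R ?Lap (u - v)) + norm (\<alpha> *\<^sub>R restr I (a * Dminus a - b * Dminus b))
     + norm (\<beta> *\<^sub>R (cubic \<gamma> a - cubic \<gamma> b)) + norm (lam *\<^sub>R (a - b))"
    by (meson add_mono norm_triangle_ineq norm_triangle_ineq4 order_trans order_refl)
  also have "\<dots> \<le> \<nu> * (4 * ?d) + \<alpha> * (2 * sqrt 5 * r * ?d) + \<beta> * (k * ?d) + lam * ?d"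
    using 1 2 3 ab \<alpha>_pos \<beta>_pos \<nu>_pos lam_pos by (intro add_mono) auto
  also have "\<dots> = L r * ?d"
    by (simp add: L_def k_def algebra_simps)
  finally show ?thesis .
qed

text \<open>The fields differ at a site \<open>i\<close> of \<open>I\<close> only if
  \<open>i + 1\<close> lies outside \<open>I\<close>; there the deleted difference lowers the
  product by \<open>\<nu>\<close> times the square of the entry. A pointwise bound is needed because
  it survives multiplication by any nonnegative weight.\<close>

lemma G_le_F:
  assumes "restr I u = u"
  shows "ell2_nth u i * ell2_nth (G I u) i \<le> ell2_nth u i * ell2_nth (F u) i"
proof (cases "i \<in> I")
  case False
  then have "ell2_nth u i = 0" using assms by (metis restr_nth)
  then show ?thesis by simp
next
  case True
  show ?thesis
  proof (cases "i + 1 \<in> I")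
    case False
    then have z: "ell2_nth u (i + 1) = 0" using assms by (metis restr_nth)
    have "ell2_nth (G I u) i = ell2_nth (F u) i - \<nu> * ell2_nth u i"
      using True False z by (simp add: G_def F_def assms add.commute[of 1]) (simp add: algebra_simps)
    then have "ell2_nth u i * ell2_nth (G I u) i
        = ell2_nth u i * ell2_nth (F u) i - \<nu> * (ell2_nth u i)\<^sup>2"
      by (simp only: right_diff_distrib power2_eq_square mult.left_commute)
    then show ?thesis using \<nu>_pos by simp
  next
    case T2: True
    have "ell2_nth (G I u) i = ell2_nth (F u) i"
      using True T2 by (simp add: G_def F_def assms algebra_simps)
    then show ?thesis by simp
  qed
qed

text \<open>Here \<open>s\<close>, \<open>sm\<close>, \<open>sp\<close> are the weights and
  \<open>x\<close>, \<open>xm\<close>, \<open>xp\<close> the entries at i, i - 1, i + 1, and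
  \<open>y\<close> is the entry of the force. The differences behind \<open>\<nu> / 2\<close> and
  \<open>\<alpha> / 3\<close> will sum to zero over Z; the last line is the price of giving each
  neighbour its own weight.\<close>

lemma energy_pointwise:
  fixes s sm sp x xm xp r \<kappa> y :: real
  assumes "0 \<le> s" and "\<bar>s - sm\<bar> \<le> \<kappa>" and "\<bar>s - sp\<bar> \<le> \<kappa>" and "\<bar>xm\<bar> \<le> r"
  shows "s * (x * (\<nu> * (- xm + 2 * x - xp) - \<alpha> * (x * (xm - x))
            + \<beta> * (x * (1 - x) * (x - \<gamma>)) - lam * x + y))
       \<le> - \<delta> * (s * x\<^sup>2) + s * (x * y)
          + \<nu> / 2 * ((sm * xm\<^sup>2 - s * x\<^sup>2) + (sp * xp\<^sup>2 - s * x\<^sup>2))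
          + \<alpha> / 3 * (sm * \<bar>xm\<bar> ^ 3 - s * \<bar>x\<bar> ^ 3)
          + \<kappa> * (\<nu> / 2 * (xm\<^sup>2 + xp\<^sup>2) + \<alpha> / 3 * (r * xm\<^sup>2))"
proof -
  define t where "t = \<bar>x\<bar>"
  have t2: "t\<^sup>2 = x\<^sup>2" by (simp add: t_def)
  \<comment> \<open>Young's inequality in both mixed products leaves 3 x^2 and half of each
    neighbouring square; after shifting, this is the 4 of \<open>lam_star\<close>.\<close>
  have 1: "s * (\<nu> * (x * (- xm + 2 * x - xp)))
      \<le> \<nu> * (4 * (s * x\<^sup>2)) + \<nu> / 2 * ((sm * xm\<^sup>2 - s * x\<^sup>2) + (sp * xp\<^sup>2 - s * x\<^sup>2))
        + \<kappa> * (\<nu> / 2 * (xm\<^sup>2 + xp\<^sup>2))"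
  proof -
    have "x * (- xm + 2 * x - xp) \<le> 3 * x\<^sup>2 + xm\<^sup>2 / 2 + xp\<^sup>2 / 2"
      using zero_le_power2[of "x + xm"] zero_le_power2[of "x + xp"]
      by (simp add: power2_sum algebra_simps power2_eq_square)
    then have "s * (x * (- xm + 2 * x - xp)) \<le> s * (3 * x\<^sup>2 + xm\<^sup>2 / 2 + xp\<^sup>2 / 2)"
      using assms(1) by (rule mult_left_mono)
    moreover have "s * xm\<^sup>2 \<le> (sm + \<kappa>) * xm\<^sup>2" "s * xp\<^sup>2 \<le> (sp + \<kappa>) * xp\<^sup>2"
      using assms(2,3) by (auto intro!: mult_right_mono)
    ultimately have "s * (x * (- xm + 2 * x - xp))
        \<le> 4 * (s * x\<^sup>2) + ((sm * xm\<^sup>2 - s * x\<^sup>2) + (sp * xp\<^sup>2 - s * x\<^sup>2)) / 2 + \<kappa> * ((xm\<^sup>2 + xp\<^sup>2) / 2)"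
      by (simp add: algebra_simps add_divide_distrib diff_divide_distrib)
    from mult_left_mono[OF this, of \<nu>] \<nu>_pos
    have "s * (\<nu> * (x * (- xm + 2 * x - xp))) \<le> \<nu> * (4 * (s * x\<^sup>2)
        + ((sm * xm\<^sup>2 - s * x\<^sup>2) + (sp * xp\<^sup>2 - s * x\<^sup>2)) / 2 + \<kappa> * ((xm\<^sup>2 + xp\<^sup>2) / 2))"
      by (simp add: mult.left_commute)
    also have "\<dots> = \<nu> * (4 * (s * x\<^sup>2))
        + \<nu> / 2 * ((sm * xm\<^sup>2 - s * x\<^sup>2) + (sp * xp\<^sup>2 - s * x\<^sup>2)) + \<kappa> * (\<nu> / 2 * (xm\<^sup>2 + xp\<^sup>2))"
      by (simp add: field_simps)
    finally show ?thesis .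
  qed
  \<comment> \<open>Young's inequality leaves 1 + 2/3 cubes at i and 1/3 of a cube at i - 1; after
    shifting, this is the factor 2 of \<open>\<alpha>\<close> in \<open>lam_star\<close>.\<close>
  have 2: "s * (\<alpha> * (- (x * (x * (xm - x)))))
      \<le> \<alpha> * (2 * (s * t ^ 3)) + \<alpha> / 3 * (sm * \<bar>xm\<bar> ^ 3 - s * t ^ 3) + \<kappa> * (\<alpha> / 3 * (r * xm\<^sup>2))"
  proof -
    have "- (x * (x * (xm - x))) = x\<^sup>2 * (- xm) + x\<^sup>2 * x"
      by (simp add: algebra_simps power2_eq_square)
    also have "\<dots> \<le> t\<^sup>2 * \<bar>xm\<bar> + t\<^sup>2 * t"
      unfolding t2 by (intro add_mono mult_left_mono) (auto simp: t_def)
    also have "\<dots> \<le> (2 * t ^ 3 + \<bar>xm\<bar> ^ 3) / 3 + t ^ 3"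
      using young_cubic[of t "\<bar>xm\<bar>"] by (simp add: t_def power2_eq_square power3_eq_cube)
    finally have "s * (- (x * (x * (xm - x)))) \<le> s * ((2 * t ^ 3 + \<bar>xm\<bar> ^ 3) / 3 + t ^ 3)"
      using assms(1) by (rule mult_left_mono)
    moreover have "s * \<bar>xm\<bar> ^ 3 \<le> sm * \<bar>xm\<bar> ^ 3 + \<kappa> * (r * xm\<^sup>2)"
    proof -
      have "s * \<bar>xm\<bar> ^ 3 \<le> (sm + \<kappa>) * \<bar>xm\<bar> ^ 3"
        using assms(2) by (intro mult_right_mono) auto
      moreover have "\<bar>xm\<bar> ^ 3 \<le> r * xm\<^sup>2"
        using mult_right_mono[OF assms(4), of "xm\<^sup>2"] by (simp add: power3_eq_cube power2_eq_square)
      moreover have "0 \<le> \<kappa>" using assms(2) by linarith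
      ultimately show ?thesis
        using mult_left_mono[of "\<bar>xm\<bar> ^ 3" "r * xm\<^sup>2" \<kappa>] by (simp add: algebra_simps)
    qed
    ultimately have "s * (- (x * (x * (xm - x))))
        \<le> 2 * (s * t ^ 3) + (sm * \<bar>xm\<bar> ^ 3 - s * t ^ 3) / 3 + \<kappa> * (r * xm\<^sup>2) / 3"
      by (simp add: algebra_simps add_divide_distrib diff_divide_distrib)
    from mult_left_mono[OF this, of \<alpha>] \<alpha>_pos
    have "s * (\<alpha> * (- (x * (x * (xm - x))))) \<le> \<alpha> * (2 * (s * t ^ 3)
        + (sm * \<bar>xm\<bar> ^ 3 - s * t ^ 3) / 3 + \<kappa> * (r * xm\<^sup>2) / 3)"
      by (simp only: mult.left_commute less_imp_le)
    also have "\<dots> = \<alpha> * (2 * (s * t ^ 3)) + \<alpha> / 3 * (sm * \<bar>xm\<bar> ^ 3 - s * t ^ 3)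
        + \<kappa> * (\<alpha> / 3 * (r * xm\<^sup>2))"
      by (simp add: field_simps)
    finally show ?thesis .
  qed
  \<comment> \<open>Reaction and transport together give the quadratic
    \<open>- \<beta> * t\<^sup>2 + p * t - \<beta> * \<gamma>\<close> in the modulus
    \<open>t\<close>; its maximum \<open>p\<^sup>2 / (4 * \<beta>) - \<beta> * \<gamma>\<close> is
    the rest of \<open>lam_star\<close>.\<close>
  have 3: "s * (\<beta> * (x * (x * (1 - x) * (x - \<gamma>)))) + \<alpha> * (2 * (s * t ^ 3))
      \<le> (lam_star - 4 * \<nu>) * (s * x\<^sup>2)"
  proof -
    define p where "p = 2 * \<alpha> + \<beta> + \<beta> * \<gamma>"
    have "\<beta> * ((1 - x) * (x - \<gamma>)) \<le> - \<beta> * t\<^sup>2 + (\<beta> + \<beta> * \<gamma>) * t - \<beta> * \<gamma>"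
    proof -
      have "\<beta> * ((1 + \<gamma>) * x) \<le> \<beta> * ((1 + \<gamma>) * t)"
        using \<beta>_pos \<gamma>_pos by (intro mult_left_mono) (auto simp: t_def)
      moreover have "\<beta> * ((1 - x) * (x - \<gamma>)) = - \<beta> * x\<^sup>2 + \<beta> * ((1 + \<gamma>) * x) - \<beta> * \<gamma>"
        by (simp add: algebra_simps power2_eq_square)
      moreover have "(\<beta> + \<beta> * \<gamma>) * t = \<beta> * ((1 + \<gamma>) * t)"
        by (simp add: algebra_simps)
      ultimately show ?thesis unfolding t2 by linarith
    qed
    then have "\<beta> * ((1 - x) * (x - \<gamma>)) + 2 * \<alpha> * t \<le> - \<beta> * t\<^sup>2 + p * t - \<beta> * \<gamma>"
      by (simp add: p_def algebra_simps)
    also have "\<dots> \<le> p\<^sup>2 / (4 * \<beta>) - \<beta> * \<gamma>"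
    proof -
      have "0 \<le> (2 * \<beta> * t - p)\<^sup>2 / (4 * \<beta>)" using \<beta>_pos by simp
      also have "\<dots> = \<beta> * t\<^sup>2 - p * t + p\<^sup>2 / (4 * \<beta>)"
        using \<beta>_pos by (simp add: field_simps power2_eq_square)
      finally show ?thesis by simp
    qed
    also have "\<dots> = lam_star - 4 * \<nu>" by (simp add: lam_star_def p_def)
    finally have "(s * x\<^sup>2) * (\<beta> * ((1 - x) * (x - \<gamma>)) + 2 * \<alpha> * t) \<le> (s * x\<^sup>2) * (lam_star - 4 * \<nu>)"
      using assms(1) by (intro mult_left_mono) auto
    moreover have "(s * x\<^sup>2) * (2 * \<alpha> * t) = \<alpha> * (2 * (s * t ^ 3))"
      unfolding t2[symmetric] by (simp add: power2_eq_square power3_eq_cube)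
    moreover have "s * (\<beta> * (x * (x * (1 - x) * (x - \<gamma>)))) = (s * x\<^sup>2) * (\<beta> * ((1 - x) * (x - \<gamma>)))"
      by (simp add: power2_eq_square)
    ultimately show ?thesis
      unfolding distrib_left by (simp only: mult.commute[of "lam_star - 4 * \<nu>"])
  qed
  have "s * (x * (\<nu> * (- xm + 2 * x - xp) - \<alpha> * (x * (xm - x))
            + \<beta> * (x * (1 - x) * (x - \<gamma>)) - lam * x + y))
    = s * (\<nu> * (x * (- xm + 2 * x - xp))) + s * (\<alpha> * (- (x * (x * (xm - x)))))
      + s * (\<beta> * (x * (x * (1 - x) * (x - \<gamma>)))) - lam * (s * x\<^sup>2) + s * (x * y)"
    by (simp add: algebra_simps power2_eq_square)
  also have "\<dots> \<le> - \<delta> * (s * x\<^sup>2) + s * (x * y)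
          + \<nu> / 2 * ((sm * xm\<^sup>2 - s * x\<^sup>2) + (sp * xp\<^sup>2 - s * x\<^sup>2))
          + \<alpha> / 3 * (sm * \<bar>xm\<bar> ^ 3 - s * t ^ 3)
          + (\<kappa> * (\<nu> / 2 * (xm\<^sup>2 + xp\<^sup>2)) + \<kappa> * (\<alpha> / 3 * (r * xm\<^sup>2)))"
  proof -
    have "- \<delta> * (s * x\<^sup>2) = \<nu> * (4 * (s * x\<^sup>2)) + (lam_star - 4 * \<nu>) * (s * x\<^sup>2) - lam * (s * x\<^sup>2)"
      by (simp add: \<delta>_def algebra_simps)
    with 1 2 3 show ?thesis by linarith
  qed
  finally show ?thesis unfolding t_def by (simp only: distrib_left)
qed

end

subsection \<open>Energy and tail estimates\<close>

definition wnorm2 :: "(int \<Rightarrow> real) \<Rightarrow> ell2 \<Rightarrow> real" where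
  "wnorm2 \<xi> u = (\<Sum>\<^sub>\<infinity>i. \<xi> i * (ell2_nth u i)\<^sup>2)"

definition winner :: "(int \<Rightarrow> real) \<Rightarrow> ell2 \<Rightarrow> ell2 \<Rightarrow> real" where
  "winner \<xi> u v = (\<Sum>\<^sub>\<infinity>i. \<xi> i * (ell2_nth u i * ell2_nth v i))"

lemma summable_on_boundedI:
  fixes g h :: "int \<Rightarrow> real"
  assumes "h summable_on UNIV" and "\<And>i. \<bar>g i\<bar> \<le> C * h i"
  shows "g summable_on UNIV"
proof -
  have "(\<lambda>i. C * h i) summable_on UNIV"
    by (intro summable_on_cmult_right assms(1))
  then have "(\<lambda>i. norm (g i)) summable_on UNIV"
    by (rule summable_on_comparison_test) (use assms(2) in auto)
  then show ?thesis by (rule abs_summable_summable)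
qed

lemma has_sum_minus:
  fixes g h :: "'a \<Rightarrow> real"
  assumes "(g has_sum a) A" and "(h has_sum b) A"
  shows "((\<lambda>x. g x - h x) has_sum (a - b)) A"
  using has_sum_add[OF assms(1) has_sum_cmult_right[OF assms(2), of "- 1"]] by simp

text \<open>Translation invariance of sums over Z; this is what removes the neighbour differences
  from the energy.\<close>

lemma has_sum_shift_diff:
  fixes p :: "int \<Rightarrow> real"
  assumes "p summable_on UNIV"
  shows "((\<lambda>i. p (i + k) - p i) has_sum 0) UNIV"
proof -
  have "((\<lambda>i. p (i + k)) has_sum infsum p UNIV) UNIV"
    using has_sum_infsum[OF summable_shift_int[OF assms, of k]] by (simp add: infsum_shift_int)
  from has_sum_minus[OF this has_sum_infsum[OF assms]] show ?thesis by simp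
qed

text \<open>Used with the constant weight 1 for the norm bound and with \<open>cutoff k\<close> for
  the tail bound.\<close>

locale unit_weight =
  fixes \<xi> :: "int \<Rightarrow> real"
  assumes nonneg: "0 \<le> \<xi> i" and le_one: "\<xi> i \<le> 1"
begin

lemma has_sum_wnorm2: "((\<lambda>i. \<xi> i * (ell2_nth u i)\<^sup>2) has_sum wnorm2 \<xi> u) UNIV"
  unfolding wnorm2_def
  by (intro has_sum_infsum summable_on_boundedI[OF ell2_nth_summable(1)[of u], where C = 1])
     (auto simp: abs_mult nonneg le_one intro: mult_left_le_one_le)

lemma has_sum_winner: "((\<lambda>i. \<xi> i * (ell2_nth u i * ell2_nth v i)) has_sum winner \<xi> u v) UNIV"
  unfolding winner_def
proof (intro has_sum_infsum)
  have "(\<lambda>i. (ell2_nth u i)\<^sup>2 + (ell2_nth v i)\<^sup>2) summable_on UNIV"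
    by (intro summable_on_add ell2_nth_summable)
  then show "(\<lambda>i. \<xi> i * (ell2_nth u i * ell2_nth v i)) summable_on UNIV"
  proof (rule summable_on_boundedI[where C = 1])
    fix i
    have "\<bar>\<xi> i * (ell2_nth u i * ell2_nth v i)\<bar> \<le> \<bar>ell2_nth u i * ell2_nth v i\<bar>"
      by (auto simp: abs_mult nonneg le_one intro: mult_left_le_one_le)
    also have "\<dots> \<le> (ell2_nth u i)\<^sup>2 + (ell2_nth v i)\<^sup>2"
      using zero_le_power2[of "\<bar>ell2_nth u i\<bar> - \<bar>ell2_nth v i\<bar>"]
      unfolding power2_diff abs_mult power2_abs
      using mult_nonneg_nonneg[OF abs_ge_zero[of "ell2_nth u i"] abs_ge_zero[of "ell2_nth v i"]]
      by linarith
    finally show "\<bar>\<xi> i * (ell2_nth u i * ell2_nth v i)\<bar> \<le> 1 * ((ell2_nth u i)\<^sup>2 + (ell2_nth v i)\<^sup>2)" by simp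
  qed
qed

lemma winner_le:
  assumes "a > 0"
  shows "winner \<xi> u v \<le> a / 2 * wnorm2 \<xi> u + 1 / (2 * a) * wnorm2 \<xi> v"
proof (rule has_sum_mono[OF has_sum_winner])
  show "((\<lambda>i. a / 2 * (\<xi> i * (ell2_nth u i)\<^sup>2) + 1 / (2 * a) * (\<xi> i * (ell2_nth v i)\<^sup>2))
      has_sum (a / 2 * wnorm2 \<xi> u + 1 / (2 * a) * wnorm2 \<xi> v)) UNIV"
    by (intro has_sum_add has_sum_cmult_right has_sum_wnorm2)
  fix i
  let ?x = "ell2_nth u i" and ?y = "ell2_nth v i"
  have "0 \<le> (a * ?x - ?y)\<^sup>2 / (2 * a)" using assms by simp
  also have "\<dots> = a / 2 * ?x\<^sup>2 + 1 / (2 * a) * ?y\<^sup>2 - ?x * ?y"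
    using assms by (simp add: power2_eq_square field_simps)
  finally have "\<xi> i * (?x * ?y) \<le> \<xi> i * (a / 2 * ?x\<^sup>2 + 1 / (2 * a) * ?y\<^sup>2)"
    by (intro mult_left_mono nonneg) simp
  then show "\<xi> i * (?x * ?y) \<le> a / 2 * (\<xi> i * ?x\<^sup>2) + 1 / (2 * a) * (\<xi> i * ?y\<^sup>2)"
    by (simp add: algebra_simps)
qed

lemma wnorm2_le_norm: "wnorm2 \<xi> u \<le> (norm u)\<^sup>2"
  unfolding norm_ell2_power2
  by (rule has_sum_mono[OF has_sum_wnorm2 has_sum_infsum[OF ell2_nth_summable(1)]])
     (simp add: nonneg le_one mult_left_le_one_le)

lemma wnorm2_le_tail:
  assumes "\<And>i. i \<in> I \<Longrightarrow> \<xi> i = 0"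
  shows "wnorm2 \<xi> u \<le> (norm (u - restr I u))\<^sup>2"
  unfolding norm_ell2_power2
  by (rule has_sum_mono[OF has_sum_wnorm2 has_sum_infsum[OF ell2_nth_summable(1)]])
     (use assms in \<open>auto simp: nonneg le_one mult_left_le_one_le\<close>)

lemma tail_le_wnorm2:
  assumes "\<And>i. i \<notin> I \<Longrightarrow> \<xi> i = 1"
  shows "(norm (u - restr I u))\<^sup>2 \<le> wnorm2 \<xi> u"
  unfolding norm_ell2_power2
  by (rule has_sum_mono[OF has_sum_infsum[OF ell2_nth_summable(1)] has_sum_wnorm2])
     (use assms in \<open>auto simp: nonneg\<close>)

end

lemma wnorm2_one: "wnorm2 (\<lambda>_. 1) u = (norm u)\<^sup>2"
  by (simp add: wnorm2_def norm_ell2_power2)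

lemma winner_one: "winner (\<lambda>_. 1) u v = inner u v"
  unfolding winner_def by transfer simp

context dissipative_lattice
begin

lemma weighted_energy:
  assumes \<xi>: "unit_weight \<xi>" "\<And>i. \<bar>\<xi> (i + 1) - \<xi> i\<bar> \<le> \<kappa>"
    and "norm u \<le> r"
  shows "winner \<xi> u (F u) \<le> - \<delta> * wnorm2 \<xi> u + winner \<xi> u f + \<kappa> * (\<nu> + \<alpha> / 3 * r) * (norm u)\<^sup>2"
proof -
  interpret unit_weight \<xi> by (rule \<xi>(1))
  let ?u = "ell2_nth u"
  have ui: "\<bar>?u i\<bar> \<le> r" for i
    using abs_ell2_nth_le_norm[of u i] assms(3) by linarith
  have s2: "((\<lambda>i. (?u i)\<^sup>2) has_sum (norm u)\<^sup>2) UNIV"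
    unfolding norm_ell2_power2 by (intro has_sum_infsum ell2_nth_summable)
  have s2': "((\<lambda>i. (?u (i + k))\<^sup>2) has_sum (norm u)\<^sup>2) UNIV" for k
    using has_sum_infsum[OF summable_shift_int[OF ell2_nth_summable(1), of u k]]
      infsum_shift_int[of "\<lambda>i. (?u i)\<^sup>2" k] by (simp add: norm_ell2_power2)
  have q: "(\<lambda>i. \<xi> i * \<bar>?u i\<bar> ^ 3) summable_on UNIV"
  proof (rule summable_on_boundedI[OF ell2_nth_summable(1)])
    fix i
    have "\<bar>\<xi> i * \<bar>?u i\<bar> ^ 3\<bar> \<le> \<bar>?u i\<bar> ^ 3"
      by (auto simp: abs_mult nonneg le_one intro: mult_left_le_one_le)
    also have "\<dots> \<le> r * (?u i)\<^sup>2"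
      using mult_right_mono[OF ui[of i], of "(?u i)\<^sup>2"] by (simp add: power3_eq_cube power2_eq_square)
    finally show "\<bar>\<xi> i * \<bar>?u i\<bar> ^ 3\<bar> \<le> r * (?u i)\<^sup>2" .
  qed
  have p: "(\<lambda>i. \<xi> i * (?u i)\<^sup>2) summable_on UNIV"
    using has_sum_wnorm2 by (rule has_sum_imp_summable)
  \<comment> \<open>The pointwise majorant, with \<open>i + - 1\<close> in place of
    \<open>i - 1\<close> so that both neighbours are instances of a shift by k.\<close>
  have sum: "((\<lambda>i. - \<delta> * (\<xi> i * (?u i)\<^sup>2) + \<xi> i * (?u i * ell2_nth f i)
          + \<nu> / 2 * ((\<xi> (i + - 1) * (?u (i + - 1))\<^sup>2 - \<xi> i * (?u i)\<^sup>2)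
              + (\<xi> (i + 1) * (?u (i + 1))\<^sup>2 - \<xi> i * (?u i)\<^sup>2))
          + \<alpha> / 3 * (\<xi> (i + - 1) * \<bar>?u (i + - 1)\<bar> ^ 3 - \<xi> i * \<bar>?u i\<bar> ^ 3)
          + \<kappa> * (\<nu> / 2 * ((?u (i + - 1))\<^sup>2 + (?u (i + 1))\<^sup>2) + \<alpha> / 3 * (r * (?u (i + - 1))\<^sup>2)))
     has_sum (- \<delta> * wnorm2 \<xi> u + winner \<xi> u f + \<nu> / 2 * (0 + 0) + \<alpha> / 3 * 0
          + \<kappa> * (\<nu> / 2 * ((norm u)\<^sup>2 + (norm u)\<^sup>2) + \<alpha> / 3 * (r * (norm u)\<^sup>2)))) UNIV"
    by (intro has_sum_add has_sum_cmult_right has_sum_wnorm2 has_sum_winner s2'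
        has_sum_shift_diff[OF p] has_sum_shift_diff[OF q])
  have "winner \<xi> u (F u) \<le> - \<delta> * wnorm2 \<xi> u + winner \<xi> u f + \<nu> / 2 * (0 + 0) + \<alpha> / 3 * 0
          + \<kappa> * (\<nu> / 2 * ((norm u)\<^sup>2 + (norm u)\<^sup>2) + \<alpha> / 3 * (r * (norm u)\<^sup>2))"
  proof (rule has_sum_mono[OF has_sum_winner sum])
    fix i
    have F: "ell2_nth (F u) i = \<nu> * (- ?u (i + - 1) + 2 * ?u i - ?u (i + 1))
        - \<alpha> * (?u i * (?u (i + - 1) - ?u i)) + \<beta> * (?u i * (1 - ?u i) * (?u i - \<gamma>))
        - lam * ?u i + ell2_nth f i"
      by (simp add: F_def)
    show "\<xi> i * (?u i * ell2_nth (F u) i) \<le> - \<delta> * (\<xi> i * (?u i)\<^sup>2) + \<xi> i * (?u i * ell2_nth f i)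
          + \<nu> / 2 * ((\<xi> (i + - 1) * (?u (i + - 1))\<^sup>2 - \<xi> i * (?u i)\<^sup>2)
              + (\<xi> (i + 1) * (?u (i + 1))\<^sup>2 - \<xi> i * (?u i)\<^sup>2))
          + \<alpha> / 3 * (\<xi> (i + - 1) * \<bar>?u (i + - 1)\<bar> ^ 3 - \<xi> i * \<bar>?u i\<bar> ^ 3)
          + \<kappa> * (\<nu> / 2 * ((?u (i + - 1))\<^sup>2 + (?u (i + 1))\<^sup>2) + \<alpha> / 3 * (r * (?u (i + - 1))\<^sup>2))"
      unfolding F
    proof (rule energy_pointwise)
      show "\<bar>\<xi> i - \<xi> (i + - 1)\<bar> \<le> \<kappa>" using \<xi>(2)[of "i - 1"] by simp
      show "\<bar>\<xi> i - \<xi> (i + 1)\<bar> \<le> \<kappa>" using \<xi>(2)[of i] by linarith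
    qed (use nonneg ui in auto)
  qed
  then show ?thesis by (simp add: algebra_simps)
qed

text \<open>The step is tested with the weight times \<open>u\<close>. Only products of
  \<open>u\<close> with the field enter, so \<open>G_le_F\<close> replaces \<open>G I\<close> by
  \<open>F\<close> and the bound no longer sees \<open>I\<close>.\<close>

lemma euler_weighted_energy:
  assumes \<xi>: "unit_weight \<xi>" "\<And>i. \<bar>\<xi> (i + 1) - \<xi> i\<bar> \<le> \<kappa>"
    and u: "u = y + \<epsilon> *\<^sub>R G I u" "restr I u = u" and r: "norm u \<le> r" and e: "0 \<le> \<epsilon>"
  shows "wnorm2 \<xi> u - winner \<xi> u y
    \<le> \<epsilon> * (- \<delta> * wnorm2 \<xi> u + winner \<xi> u f + \<kappa> * (\<nu> + \<alpha> / 3 * r) * (norm u)\<^sup>2)"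
proof -
  interpret unit_weight \<xi> by (rule \<xi>(1))
  have "wnorm2 \<xi> u - winner \<xi> u y \<le> \<epsilon> * winner \<xi> u (F u)"
  proof (rule has_sum_mono[OF has_sum_minus[OF has_sum_wnorm2 has_sum_winner]
        has_sum_cmult_right[OF has_sum_winner]])
    fix i
    let ?x = "ell2_nth u i"
    have "ell2_nth u i = ell2_nth y i + \<epsilon> * ell2_nth (G I u) i"
      using arg_cong[OF u(1), of "\<lambda>v. ell2_nth v i"] by simp
    then have "?x\<^sup>2 - ?x * ell2_nth y i = \<epsilon> * (?x * ell2_nth (G I u) i)"
      by (metis add_diff_cancel_left' distrib_left mult.left_commute power2_eq_square)
    also have "\<dots> \<le> \<epsilon> * (?x * ell2_nth (F u) i)"
      using G_le_F[OF u(2)] e by (rule mult_left_mono)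
    finally have "\<xi> i * (?x\<^sup>2 - ?x * ell2_nth y i) \<le> \<xi> i * (\<epsilon> * (?x * ell2_nth (F u) i))"
      using nonneg by (rule mult_left_mono)
    then show "\<xi> i * ?x\<^sup>2 - \<xi> i * (?x * ell2_nth y i) \<le> \<epsilon> * (\<xi> i * (?x * ell2_nth (F u) i))"
      by (simp add: algebra_simps)
  qed
  also have "\<dots> \<le> \<epsilon> * (- \<delta> * wnorm2 \<xi> u + winner \<xi> u f + \<kappa> * (\<nu> + \<alpha> / 3 * r) * (norm u)\<^sup>2)"
    using weighted_energy[OF \<xi> r] e by (rule mult_left_mono)
  finally show ?thesis .
qed

text \<open>The constant weight has variation 0, so only dissipation and force remain;
  Cauchy-Schwarz then allows division by the norm of \<open>u\<close>.\<close>

lemma euler_norm_le: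
  assumes u: "u = y + \<epsilon> *\<^sub>R G I u" "restr I u = u" and e: "0 \<le> \<epsilon>"
  shows "(1 + \<epsilon> * \<delta>) * norm u \<le> norm y + \<epsilon> * norm f"
proof -
  have "(norm u)\<^sup>2 - inner u y \<le> \<epsilon> * (- \<delta> * (norm u)\<^sup>2 + inner u f)"
    using euler_weighted_energy[of "\<lambda>_. 1" 0, OF _ _ u order_refl e]
    by (simp add: unit_weight_def wnorm2_one winner_one)
  moreover have "inner u y \<le> norm u * norm y" "\<epsilon> * inner u f \<le> \<epsilon> * (norm u * norm f)"
    using e by (auto intro: norm_cauchy_schwarz mult_left_mono)
  ultimately have "norm u * ((1 + \<epsilon> * \<delta>) * norm u) \<le> norm u * (norm y + \<epsilon> * norm f)"
    by (simp add: algebra_simps power2_eq_square)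
  then show ?thesis using e by (cases "norm u = 0") (auto simp: mult_le_cancel_left)
qed

text \<open>Young's inequality twice: half of the weighted square of \<open>u\<close> absorbs the
  datum, half of the dissipation absorbs the force. The remainder is small when the weight is flat
  and sits where \<open>f\<close> is small.\<close>

lemma euler_weighted_contraction:
  assumes \<xi>: "unit_weight \<xi>" "\<And>i. \<bar>\<xi> (i + 1) - \<xi> i\<bar> \<le> \<kappa>"
    and u: "u = y + \<epsilon> *\<^sub>R G I u" "restr I u = u" and r: "norm u \<le> r" and e: "0 \<le> \<epsilon>"
  shows "(1 + \<epsilon> * \<delta>) * wnorm2 \<xi> u
    \<le> wnorm2 \<xi> y + \<epsilon> * (wnorm2 \<xi> f / \<delta> + 2 * \<kappa> * (\<nu> + \<alpha> / 3 * r) * r\<^sup>2)"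
proof -
  interpret unit_weight \<xi> by (rule \<xi>(1))
  have r0: "0 \<le> r" using r norm_ge_zero order_trans by blast
  have \<kappa>: "0 \<le> \<kappa>" using \<xi>(2)[of 0] by linarith
  have "winner \<xi> u y \<le> wnorm2 \<xi> u / 2 + wnorm2 \<xi> y / 2"
    using winner_le[of 1 u y] by simp
  moreover have "\<epsilon> * (- \<delta> * wnorm2 \<xi> u + winner \<xi> u f + \<kappa> * (\<nu> + \<alpha> / 3 * r) * (norm u)\<^sup>2)
     \<le> \<epsilon> * (- \<delta> * wnorm2 \<xi> u + (\<delta> / 2 * wnorm2 \<xi> u + 1 / (2 * \<delta>) * wnorm2 \<xi> f)
          + \<kappa> * (\<nu> + \<alpha> / 3 * r) * r\<^sup>2)"
  proof (rule mult_left_mono[OF _ e])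
    have "\<kappa> * (\<nu> + \<alpha> / 3 * r) * (norm u)\<^sup>2 \<le> \<kappa> * (\<nu> + \<alpha> / 3 * r) * r\<^sup>2"
      using \<kappa> \<nu>_pos \<alpha>_pos r r0 by (intro mult_left_mono power_mono) auto
    with winner_le[OF \<delta>_pos, of u f]
    show "- \<delta> * wnorm2 \<xi> u + winner \<xi> u f + \<kappa> * (\<nu> + \<alpha> / 3 * r) * (norm u)\<^sup>2
        \<le> - \<delta> * wnorm2 \<xi> u + (\<delta> / 2 * wnorm2 \<xi> u + 1 / (2 * \<delta>) * wnorm2 \<xi> f)
          + \<kappa> * (\<nu> + \<alpha> / 3 * r) * r\<^sup>2" by linarith
  qed
  moreover have "\<dots> = (- (\<epsilon> * \<delta> * wnorm2 \<xi> u)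
     + \<epsilon> * (wnorm2 \<xi> f / \<delta> + 2 * \<kappa> * (\<nu> + \<alpha> / 3 * r) * r\<^sup>2)) / 2"
    using \<delta>_pos by (simp add: field_simps)
  moreover note euler_weighted_energy[OF \<xi> u r e]
  ultimately show ?thesis by (simp add: algebra_simps)
qed

end

text \<open>Zero up to distance k, one from 2k on, linear in between. The slope matters as much as
  the support: a sharp indicator would leave a variation error of fixed size.\<close>

definition cutoff :: "nat \<Rightarrow> int \<Rightarrow> real" where
  "cutoff k i = min 1 (max 0 (\<bar>real_of_int i\<bar> / real k - 1))"

lemma unit_weight_cutoff: "unit_weight (cutoff k)"
  by unfold_locales (auto simp: cutoff_def)

lemma cutoff_lipschitz:
  assumes "k > 0"
  shows "\<bar>cutoff k (i + 1) - cutoff k i\<bar> \<le> 1 / real k"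
proof -
  have "\<bar>\<bar>real_of_int (i + 1)\<bar> - \<bar>real_of_int i\<bar>\<bar> \<le> 1" by simp
  then have "\<bar>\<bar>real_of_int (i + 1)\<bar> / real k - \<bar>real_of_int i\<bar> / real k\<bar> \<le> 1 / real k"
    using assms by (simp add: divide_right_mono flip: diff_divide_distrib)
  moreover have "\<bar>min 1 (max 0 (a - 1)) - min 1 (max 0 (b - 1))\<bar> \<le> \<bar>a - b\<bar>" for a b :: real
    by linarith
  ultimately show ?thesis unfolding cutoff_def by (rule order_trans[rotated])
qed

lemma cutoff_eq_0: "k > 0 \<Longrightarrow> i \<in> idx k \<Longrightarrow> cutoff k i = 0"
  by (auto simp: cutoff_def idx_def field_simps)

lemma cutoff_eq_1: "k > 0 \<Longrightarrow> i \<notin> idx (2 * k) \<Longrightarrow> cutoff k i = 1"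
  by (auto simp: cutoff_def idx_def field_simps)

subsection \<open>The implicit Euler step\<close>

locale euler_scheme = dissipative_lattice +
  fixes \<epsilon> :: real
  assumes \<epsilon>_pos: "0 < \<epsilon>" and \<epsilon>_le: "\<epsilon> \<le> eps_star"
begin

lemma r_star_ge_1: "1 \<le> r_star"
  using \<delta>_pos by (simp add: r_star_def \<delta>_def)

text \<open>The two bounds in \<open>eps_star\<close> have separate tasks: this one keeps the fixed
  point map inside the ball of radius \<open>r_star + 1\<close>, and
  \<open>\<epsilon>_L_less\<close> makes it a contraction there.\<close>

lemma \<epsilon>_M_le: "\<epsilon> * M (r_star + 1) \<le> 1"
proof -
  have "0 < M (r_star + 1)"
    using r_star_ge_1 \<alpha>_pos \<beta>_pos \<gamma>_pos \<nu>_pos lam_pos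
    unfolding M_def by (intro add_pos_nonneg add_nonneg_nonneg mult_pos_pos mult_nonneg_nonneg) auto
  moreover have "\<epsilon> \<le> 1 / M (r_star + 1)" using \<epsilon>_le by (simp add: eps_star_def)
  ultimately show ?thesis by (simp add: field_simps)
qed

lemma L_nonneg: "0 \<le> L (r_star + 1)"
  using r_star_ge_1 \<alpha>_pos \<beta>_pos \<gamma>_pos \<nu>_pos lam_pos
  unfolding L_def by (intro add_nonneg_nonneg mult_nonneg_nonneg) auto

lemma \<epsilon>_L_less: "\<epsilon> * L (r_star + 1) < 1"
proof -
  have "\<epsilon> \<le> 1 / (1 + L (r_star + 1))" using \<epsilon>_le by (simp add: eps_star_def)
  then have "\<epsilon> * (1 + L (r_star + 1)) \<le> 1" using L_nonneg by (simp add: field_simps)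
  then show ?thesis using \<epsilon>_pos by (simp add: algebra_simps)
qed

definition step_const :: real where
  "step_const = 1 / (1 - \<epsilon> * L (r_star + 1))"

lemma step_const_ge_1: "1 \<le> step_const"
  using \<epsilon>_L_less \<epsilon>_pos L_nonneg by (simp add: step_const_def)

text \<open>Sizes are assumed of the solutions only, not of the data \<open>y\<close> and
  \<open>z\<close>; the comparison of the schemes applies this to a perturbed datum that may leave
  the ball of radius \<open>r_star\<close>.\<close>

lemma euler_step_lipschitz:
  assumes "u = y + \<epsilon> *\<^sub>R G I u" and "v = z + \<epsilon> *\<^sub>R G I v"
    and "norm u \<le> r_star + 1" and "norm v \<le> r_star + 1"
  shows "norm (u - v) \<le> step_const * norm (y - z)"
proof -
  have "u - v = (y - z) + \<epsilon> *\<^sub>R (G I u - G I v)"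
    using assms(1,2) by (metis add_diff_add scaleR_right_diff_distrib)
  then have "norm (u - v) \<le> norm (y - z) + norm (\<epsilon> *\<^sub>R (G I u - G I v))"
    by (metis norm_triangle_ineq)
  also have "\<dots> \<le> norm (y - z) + \<epsilon> * (L (r_star + 1) * norm (u - v))"
    using norm_G_diff_le[OF assms(3,4)] \<epsilon>_pos by simp
  finally have "norm (u - v) * (1 - \<epsilon> * L (r_star + 1)) \<le> norm (y - z)"
    by (simp add: algebra_simps)
  then show ?thesis using \<epsilon>_L_less by (simp add: step_const_def field_simps)
qed

definition phase :: "int set \<Rightarrow> ell2 set" where
  "phase I = {y \<in> cball 0 r_star. restr I y = y}"

lemma phase_UNIV: "phase UNIV = cball 0 r_star"
  by (auto simp: phase_def)

definition T :: "int set \<Rightarrow> ell2 \<Rightarrow> ell2" where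
  "T I y = (THE u. u \<in> cball 0 r_star \<and> u = y + \<epsilon> *\<^sub>R G I u)"

text \<open>Banach's theorem is used in the ball of radius \<open>r_star + 1\<close>, since adding
  \<open>\<epsilon>\<close> times the field moves the datum by at most 1; the energy bound then
  brings the fixed point back to radius \<open>r_star\<close>.\<close>

lemma euler_step_ex1:
  assumes "y \<in> phase I"
  shows "\<exists>!u. u \<in> cball 0 r_star \<and> u = y + \<epsilon> *\<^sub>R G I u"
proof -
  let ?R = "r_star + 1"
  have y: "norm y \<le> r_star" "restr I y = y" using assms by (auto simp: phase_def)
  have "\<exists>!u\<in>cball 0 ?R. y + \<epsilon> *\<^sub>R G I u = u"
  proof (rule Banach_fix)
    show "complete (cball (0 :: ell2) ?R)" by (simp add: complete_eq_closed)
    show "cball (0 :: ell2) ?R \<noteq> {}" using r_star_ge_1 by simp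
    show "0 \<le> \<epsilon> * L ?R" using L_nonneg \<epsilon>_pos by simp
    show "\<epsilon> * L ?R < 1" by (rule \<epsilon>_L_less)
    show "(\<lambda>u. y + \<epsilon> *\<^sub>R G I u) ` cball 0 ?R \<subseteq> cball 0 ?R"
    proof clarify
      fix u assume "u \<in> cball (0 :: ell2) ?R"
      then have "norm (G I u) \<le> M ?R" by (intro norm_G_le) simp
      from mult_left_mono[OF this less_imp_le[OF \<epsilon>_pos]] \<epsilon>_M_le
      have "\<epsilon> * norm (G I u) \<le> 1" by linarith
      then have "norm (\<epsilon> *\<^sub>R G I u) \<le> 1" using \<epsilon>_pos by simp
      then show "y + \<epsilon> *\<^sub>R G I u \<in> cball 0 ?R"
        using y(1) norm_triangle_ineq[of y "\<epsilon> *\<^sub>R G I u"] by simp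
    qed
    fix u v assume "u \<in> cball (0 :: ell2) ?R" "v \<in> cball (0 :: ell2) ?R"
    then have "norm (G I u - G I v) \<le> L ?R * norm (u - v)" by (intro norm_G_diff_le) auto
    then have "\<epsilon> * norm (G I u - G I v) \<le> \<epsilon> * (L ?R * norm (u - v))"
      using \<epsilon>_pos by simp
    then show "dist (y + \<epsilon> *\<^sub>R G I u) (y + \<epsilon> *\<^sub>R G I v) \<le> \<epsilon> * L ?R * dist u v"
      using \<epsilon>_pos by (simp add: dist_norm flip: scaleR_right_diff_distrib)
  qed
  then obtain u where u: "u \<in> cball 0 ?R" "u = y + \<epsilon> *\<^sub>R G I u"
    and unique: "\<And>v. v \<in> cball 0 ?R \<Longrightarrow> v = y + \<epsilon> *\<^sub>R G I v \<Longrightarrow> v = u"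
    by (metis (no_types, lifting))
  \<comment> \<open>The solution inherits its support from the datum and the field, which
    \<open>euler_norm_le\<close> requires.\<close>
  have "restr I (y + \<epsilon> *\<^sub>R G I u) = y + \<epsilon> *\<^sub>R G I u"
    using y(2) by (simp add: restr_add restr_scaleR)
  then have "restr I u = u" by (simp only: u(2)[symmetric])
  from euler_norm_le[OF u(2) this] \<epsilon>_pos y(1)
  have "(1 + \<epsilon> * \<delta>) * norm u \<le> r_star + \<epsilon> * norm f" by simp
  \<comment> \<open>This identity is the reason for the choice of \<open>r_star\<close>: the a
    priori bound reproduces the ball.\<close>
  also have "norm f = \<delta> * (r_star - 1)"
    using \<delta>_pos by (simp add: r_star_def \<delta>_def)
  also have "r_star + \<epsilon> * (\<delta> * (r_star - 1)) \<le> (1 + \<epsilon> * \<delta>) * r_star"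
    using \<epsilon>_pos \<delta>_pos by (simp add: algebra_simps)
  finally have "norm u \<le> r_star"
    using \<epsilon>_pos \<delta>_pos by (simp add: add_pos_pos)
  with u(2) unique show ?thesis
    by (intro ex1I[of _ u]) auto
qed

lemma T_eqI:
  assumes "y \<in> phase I" and "norm u \<le> r_star" and "u = y + \<epsilon> *\<^sub>R G I u"
  shows "T I y = u"
  unfolding T_def using assms by (intro the1_equality[OF euler_step_ex1]) auto

lemma T_step:
  assumes "y \<in> phase I"
  shows "norm (T I y) \<le> r_star" and "T I y = y + \<epsilon> *\<^sub>R G I (T I y)"
  using theI'[OF euler_step_ex1[OF assms]] unfolding T_def[symmetric] by auto

lemma T_phase:
  assumes "y \<in> phase I"
  shows "T I y \<in> phase I"
proof -
  have "restr I (y + \<epsilon> *\<^sub>R G I (T I y)) = y + \<epsilon> *\<^sub>R G I (T I y)"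
    using assms by (simp add: phase_def restr_add restr_scaleR)
  then have "restr I (T I y) = T I y" by (simp only: T_step(2)[OF assms, symmetric])
  with T_step(1)[OF assms] show ?thesis by (simp add: phase_def)
qed

lemma funpow_T_phase: "y \<in> phase I \<Longrightarrow> (T I ^^ n) y \<in> phase I"
  by (induction n) (auto intro: T_phase)

text \<open>\<open>?h / \<delta>\<close> is the fixed point of the affine recursion a -> (a + eps h)
  / (1 + eps delta) given by \<open>euler_weighted_contraction\<close>; the initial energy decays at
  the rate \<open>?q\<close>.\<close>

lemma T_tail_estimate:
  assumes "y \<in> phase I" and "k > 0"
  shows "wnorm2 (cutoff k) ((T I ^^ n) y) \<le> (1 / (1 + \<epsilon> * \<delta>)) ^ n * r_star\<^sup>2
     + (wnorm2 (cutoff k) f / \<delta> + 2 * (1 / real k) * (\<nu> + \<alpha> / 3 * r_star) * r_star\<^sup>2) / \<delta>"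
    (is "_ \<le> ?q ^ n * _ + ?h / \<delta>")
proof (induction n)
  case 0
  interpret unit_weight "cutoff k" by (rule unit_weight_cutoff)
  have "0 \<le> wnorm2 (cutoff k) f"
    using has_sum_nonneg[OF has_sum_wnorm2] nonneg by simp
  then have "0 \<le> ?h / \<delta>"
    using \<delta>_pos \<alpha>_pos \<nu>_pos r_star_ge_1 by simp
  moreover have "wnorm2 (cutoff k) y \<le> r_star\<^sup>2"
    using wnorm2_le_norm[of y] assms(1) power_mono[of "norm y" r_star 2] by (simp add: phase_def)
  ultimately show ?case by simp
next
  case (Suc n)
  let ?y = "(T I ^^ n) y" and ?u = "(T I ^^ Suc n) y"
  have y: "?y \<in> phase I" using assms(1) by (rule funpow_T_phase)
  have "restr I ?u = ?u" using funpow_T_phase[OF assms(1), of "Suc n"] by (simp add: phase_def)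
  then have "(1 + \<epsilon> * \<delta>) * wnorm2 (cutoff k) ?u \<le> wnorm2 (cutoff k) ?y + \<epsilon> * ?h"
    using T_step[OF y] \<epsilon>_pos
    by (intro euler_weighted_contraction[OF unit_weight_cutoff cutoff_lipschitz[OF assms(2)]]) auto
  also have "\<dots> \<le> (?q ^ n * r_star\<^sup>2 + ?h / \<delta>) + \<epsilon> * ?h"
    using Suc.IH by simp
  also have "\<dots> = (1 + \<epsilon> * \<delta>) * (?q ^ Suc n * r_star\<^sup>2 + ?h / \<delta>)"
  proof -
    have "?q ^ n = (1 + \<epsilon> * \<delta>) * ?q ^ Suc n"
      using \<epsilon>_pos \<delta>_pos by (simp add: add_pos_pos less_imp_neq[symmetric])
    moreover have "\<epsilon> * ?h = \<epsilon> * \<delta> * (?h / \<delta>)" using \<delta>_pos by simp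
    ultimately show ?thesis by (simp only: distrib_left distrib_right mult_1 mult.assoc)
  qed
  finally show ?case
    using \<epsilon>_pos \<delta>_pos by (simp add: mult_le_cancel_left add_pos_pos less_imp_le)
qed

text \<open>The bound of \<open>T_tail_estimate\<close> is free of \<open>I\<close>. Choosing k
  makes its stationary part small, then N makes the geometric part small. The cutoff reaches 1 only
  beyond 2k, so the witness for \<open>K\<close> is \<open>2 * k\<close>.\<close>

lemma uniform_tail:
  assumes "\<eta> > 0"
  shows "\<exists>K N. \<forall>I. \<forall>y\<in>phase I. \<forall>n\<ge>N.
    norm ((T I ^^ n) y - restr (idx K) ((T I ^^ n) y)) \<le> \<eta>"
proof -
  define h where "h k = ((norm (f - restr (idx k) f))\<^sup>2 / \<delta>
      + 2 * (1 / real k) * (\<nu> + \<alpha> / 3 * r_star) * r_star\<^sup>2) / \<delta>" for k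
  have "h \<longlonglongrightarrow> (0\<^sup>2 / \<delta> + 2 * 0 * (\<nu> + \<alpha> / 3 * r_star) * r_star\<^sup>2) / \<delta>"
    unfolding h_def using \<delta>_pos
    by (intro tendsto_intros tendsto_norm_diff_restr lim_1_over_n) auto
  then have "\<forall>\<^sub>F k in sequentially. h k < \<eta>\<^sup>2 / 2"
    using assms by (intro order_tendstoD(2)) auto
  then have "\<forall>\<^sub>F k in sequentially. h k < \<eta>\<^sup>2 / 2 \<and> k > 0"
    using eventually_gt_at_top[of 0] by eventually_elim simp
  then obtain k where k: "h k < \<eta>\<^sup>2 / 2" "k > 0"
    by (metis (mono_tags, lifting) eventually_sequentially order_refl)
  let ?q = "1 / (1 + \<epsilon> * \<delta>)"
  have q: "0 \<le> ?q" "?q < 1" using \<epsilon>_pos \<delta>_pos by (auto simp: add_pos_pos)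
  have "(\<lambda>n. ?q ^ n * r_star\<^sup>2) \<longlonglongrightarrow> 0 * r_star\<^sup>2"
    using q by (intro tendsto_intros LIMSEQ_realpow_zero)
  then have "\<forall>\<^sub>F n in sequentially. ?q ^ n * r_star\<^sup>2 < \<eta>\<^sup>2 / 2"
    using assms by (intro order_tendstoD(2)) auto
  then obtain N where N: "\<And>n. n \<ge> N \<Longrightarrow> ?q ^ n * r_star\<^sup>2 < \<eta>\<^sup>2 / 2"
    by (auto simp: eventually_sequentially)
  interpret unit_weight "cutoff k" by (rule unit_weight_cutoff)
  have f: "wnorm2 (cutoff k) f \<le> (norm (f - restr (idx k) f))\<^sup>2"
    by (rule wnorm2_le_tail) (rule cutoff_eq_0[OF k(2)])
  have "norm (x - restr (idx (2 * k)) x) \<le> \<eta>"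
    if "y \<in> phase I" "n \<ge> N" "x = (T I ^^ n) y" for I y n x
  proof -
    have "(norm (x - restr (idx (2 * k)) x))\<^sup>2 \<le> wnorm2 (cutoff k) x"
      by (rule tail_le_wnorm2) (rule cutoff_eq_1[OF k(2)])
    also have "\<dots> \<le> ?q ^ n * r_star\<^sup>2
     + (wnorm2 (cutoff k) f / \<delta> + 2 * (1 / real k) * (\<nu> + \<alpha> / 3 * r_star) * r_star\<^sup>2) / \<delta>"
      unfolding that(3) by (rule T_tail_estimate[OF that(1) k(2)])
    also have "\<dots> \<le> ?q ^ n * r_star\<^sup>2 + h k"
      unfolding h_def
      by (intro add_left_mono divide_right_mono add_right_mono f less_imp_le[OF \<delta>_pos])
    also have "\<dots> \<le> \<eta>\<^sup>2" using N[OF that(2)] k(1) by linarith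
    finally show ?thesis by (rule power2_le_imp_le) (use assms in simp)
  qed
  then show ?thesis by blast
qed

subsection \<open>The attractor in the sequence space\<close>

lemma is_euler_solution_iff:
  assumes "y \<in> cball 0 r_star"
  shows "is_euler_solution \<epsilon> y u \<longleftrightarrow> u = (\<lambda>n. (T UNIV ^^ n) y)"
proof
  assume "is_euler_solution \<epsilon> y u"
  then have u: "u 0 = y" "\<And>n. u n \<in> cball 0 r_star"
    and step: "\<And>n. n \<ge> 1 \<Longrightarrow> u n = u (n - 1) + \<epsilon> *\<^sub>R F (u n)"
    unfolding is_euler_solution_def by blast+
  have "u n = (T UNIV ^^ n) y" for n
  proof (induction n)
    case 0
    then show ?case using u(1) by simp
  next
    case (Suc n)
    have "T UNIV (u n) = u (Suc n)"
    proof (rule T_eqI)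
      show "u (Suc n) = u n + \<epsilon> *\<^sub>R G UNIV (u (Suc n))"
        unfolding G_UNIV by (metis diff_Suc_1 le_add1 plus_1_eq_Suc step)
    qed (use u(2) in \<open>auto simp: phase_UNIV\<close>)
    with Suc.IH show ?case by simp
  qed
  then show "u = (\<lambda>n. (T UNIV ^^ n) y)" by blast
next
  assume u: "u = (\<lambda>n. (T UNIV ^^ n) y)"
  have ph: "u n \<in> phase UNIV" for n
    unfolding u using assms by (intro funpow_T_phase) (simp add: phase_UNIV)
  have "u n = u (n - 1) + \<epsilon> *\<^sub>R F (u n)" if "n \<ge> 1" for n
  proof -
    have "u n = T UNIV (u (n - 1))" using that by (cases n) (auto simp: u)
    then show ?thesis using T_step(2)[OF ph[of "n - 1"]] unfolding G_UNIV by metis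
  qed
  moreover have "u 0 = y" by (simp add: u)
  ultimately show "is_euler_solution \<epsilon> y u"
    using ph unfolding is_euler_solution_def phase_UNIV by blast
qed

lemma S_eq: "y \<in> cball 0 r_star \<Longrightarrow> S \<epsilon> n y = (T UNIV ^^ n) y"
  by (simp add: S_def is_euler_solution_iff)

lemma S_image: "B \<subseteq> cball 0 r_star \<Longrightarrow> S \<epsilon> n ` B = (T UNIV ^^ n) ` B"
  using S_eq by (intro image_cong) auto

lemma is_attractor_attractor: "is_attractor \<epsilon> (attractor \<epsilon>)"
proof -
  let ?B = "cball 0 r_star :: ell2 set"
  have "\<exists>A. compact A \<and> A \<subseteq> ?B \<and> (\<forall>n. (T UNIV ^^ n) ` A = A) \<and>
           (\<lambda>n. hausdorff_semidist ((T UNIV ^^ n) ` ?B) A) \<longlonglongrightarrow> 0"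
  proof (rule attractor_exists)
    show "T UNIV ` ?B \<subseteq> ?B" using T_phase[of _ UNIV] by (auto simp: phase_UNIV)
    have "dist (T UNIV y) (T UNIV z) \<le> step_const * dist y z" if "y \<in> ?B" "z \<in> ?B" for y z
      unfolding dist_norm using T_step[of y UNIV] T_step[of z UNIV] that
      by (intro euler_step_lipschitz) (auto simp: phase_UNIV)
    then have "step_const-lipschitz_on ?B (T UNIV)"
      using step_const_ge_1 by (intro lipschitz_onI) auto
    then show "continuous_on ?B (T UNIV)" by (rule lipschitz_on_continuous_on)
    fix e :: real assume e: "e > 0"
    \<comment> \<open>A late iterate is a point of a fixed compact set plus a tail of size e/2, so
      an e/2-net of the compact set is an e-net of the image.\<close>
    obtain K n where K: "\<And>y. y \<in> phase UNIV \<Longrightarrow>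
        norm ((T UNIV ^^ n) y - restr (idx K) ((T UNIV ^^ n) y)) \<le> e / 2"
      using uniform_tail[OF half_gt_zero[OF e]] by blast
    obtain C where C: "compact C" "restr (idx K) ` ?B \<subseteq> C"
      using restr_image_subset_compact[OF finite_idx] by blast
    obtain k where k: "finite k" "C \<subseteq> (\<Union>x\<in>k. ball x (e / 2))"
      using C(1) half_gt_zero[OF e] unfolding compact_eq_totally_bounded by blast
    have "(T UNIV ^^ n) ` ?B \<subseteq> (\<Union>x\<in>k. ball x e)"
    proof clarify
      fix y assume y: "y \<in> ?B"
      let ?x = "(T UNIV ^^ n) y"
      have "?x \<in> ?B" using funpow_T_phase[of y UNIV n] y by (simp add: phase_UNIV)
      then obtain c where c: "c \<in> k" "restr (idx K) ?x \<in> ball c (e / 2)" using C(2) k(2) by blast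
      have "dist c ?x \<le> dist c (restr (idx K) ?x) + dist (restr (idx K) ?x) ?x"
        by (rule dist_triangle)
      also have "\<dots> < e"
        using c(2) K[of y] y by (simp add: phase_UNIV dist_norm norm_minus_commute)
      finally show "?x \<in> (\<Union>x\<in>k. ball x e)" using c(1) by auto
    qed
    then show "\<exists>n k. finite k \<and> (T UNIV ^^ n) ` ?B \<subseteq> (\<Union>x\<in>k. ball x e)" using k(1) by blast
  qed simp
  then obtain A where A: "compact A" "A \<subseteq> ?B" "\<And>n. (T UNIV ^^ n) ` A = A"
    "(\<lambda>n. hausdorff_semidist ((T UNIV ^^ n) ` ?B) A) \<longlonglongrightarrow> 0" by blast
  then have "is_attractor \<epsilon> A"
    unfolding is_attractor_def S_image[OF A(2)] S_image[OF order_refl] by blast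
  moreover have "A1 \<subseteq> A2" if "is_attractor \<epsilon> A1" "is_attractor \<epsilon> A2" for A1 A2
    using that unfolding is_attractor_def
    by (intro attractor_unique_subset[of "S \<epsilon>" A1 ?B A2]) (auto intro: compact_imp_closed)
  ultimately have "\<exists>!A. is_attractor \<epsilon> A" by (meson subset_antisym)
  then show ?thesis unfolding attractor_def by (rule theI')
qed

subsection \<open>The truncated scheme\<close>

lemma norm_null_expansion: "norm (null_expansion m z) = L2_set z (idx m)"
proof -
  have "(norm (null_expansion m z))\<^sup>2 = (\<Sum>\<^sub>\<infinity>i\<in>idx m. (z i)\<^sup>2)"
    unfolding norm_ell2_power2 by (rule infsum_cong_neutral) auto
  then show ?thesis
    by (simp add: L2_set_def real_sqrt_unique)
qed

lemma null_expansion_restrict: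
  "null_expansion m (restrict (ell2_nth u) (idx m)) = restr (idx m) u"
  by (rule ell2_eqI) simp

lemma restrict_null_expansion:
  "z \<in> trunc_space m \<Longrightarrow> restrict (ell2_nth (null_expansion m z)) (idx m) = z"
  by (rule ext) (auto simp: trunc_space_def PiE_def extensional_def)

lemma null_expansion_phase: "z \<in> trunc_ball m r_star \<Longrightarrow> null_expansion m z \<in> phase (idx m)"
  by (auto simp: trunc_ball_def phase_def norm_null_expansion intro: ell2_eqI)

lemma restrict_phase: "u \<in> phase (idx m) \<Longrightarrow> restrict (ell2_nth u) (idx m) \<in> trunc_ball m r_star"
  by (simp add: trunc_ball_def trunc_space_def phase_def norm_null_expansion[symmetric]
      null_expansion_restrict)

lemma matvec_Dminus:
  assumes "i \<in> idx m"
  shows "matvec m Dminus_mat z i = ell2_nth (Dminus (null_expansion m z)) i"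
proof -
  have "matvec m Dminus_mat z i
      = (\<Sum>j\<in>idx m. (if j = i then - z j else 0) + (if j = i - 1 then z j else 0))"
    using assms by (simp add: matvec_def) (intro sum.cong, auto simp: Dminus_mat_def)
  also have "\<dots> = - z i + (if i - 1 \<in> idx m then z (i - 1) else 0)"
    using assms by (simp add: sum.distrib sum.delta)
  finally show ?thesis using assms by simp
qed

text \<open>The transposed matrix subtracts an entry from its right neighbour. At i = m that
  neighbour is missing from the sum, which is what the inner restriction in \<open>G\<close>
  expresses.\<close>

lemma matvec_Lap:
  assumes "i \<in> idx m"
  shows "matvec m (Lap_mat m) z i
    = ell2_nth (restr (idx m) (Dplus (restr (idx m) (Dminus (null_expansion m z))))) i"
proof -
  let ?w = "\<lambda>k. matvec m Dminus_mat z k"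
  have "matvec m (Lap_mat m) z i = (\<Sum>j\<in>idx m. \<Sum>k\<in>idx m. Dminus_mat k i * (Dminus_mat k j * z j))"
    using assms by (simp add: matvec_def Lap_mat_def sum_distrib_right mult.assoc)
  also have "\<dots> = (\<Sum>k\<in>idx m. Dminus_mat k i * ?w k)"
    by (subst sum.swap) (simp add: matvec_def sum_distrib_left)
  also have "\<dots> = (\<Sum>k\<in>idx m. (if k = i then - ?w k else 0) + (if k = i + 1 then ?w k else 0))"
    by (rule sum.cong) (auto simp: Dminus_mat_def)
  also have "\<dots> = - ?w i + (if i + 1 \<in> idx m then ?w (i + 1) else 0)"
    using assms by (simp add: sum.distrib sum.delta)
  finally show ?thesis using assms by (simp add: matvec_Dminus)
qed

lemma null_expansion_F_trunc: "null_expansion m (F_trunc m z) = G (idx m) (null_expansion m z)"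
proof (rule ell2_eqI)
  fix i
  have P: "restr (idx m) (null_expansion m z) = null_expansion m z"
    by (rule ell2_eqI) simp
  show "ell2_nth (null_expansion m (F_trunc m z)) i = ell2_nth (G (idx m) (null_expansion m z)) i"
  proof (cases "i \<in> idx m")
    case True
    then show ?thesis unfolding G_def P
      by (simp add: F_trunc_def matvec_Lap matvec_Dminus del: Dplus_nth)
  qed (simp add: G_def)
qed

text \<open>Existence and uniqueness are transported from \<open>T (idx m)\<close>. Vectors are
  extensional functions, hence the \<open>restrict\<close> on the way back.\<close>

lemma is_euler_solution_trunc_iff:
  assumes "y \<in> trunc_ball m r_star"
  shows "is_euler_solution_trunc \<epsilon> m y v \<longleftrightarrow>
    v = (\<lambda>n. restrict (ell2_nth ((T (idx m) ^^ n) (null_expansion m y))) (idx m))"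
proof
  assume "is_euler_solution_trunc \<epsilon> m y v"
  then have v: "v 0 = y" and ball: "\<And>n. v n \<in> trunc_ball m r_star"
    and step: "\<And>n i. n \<ge> 1 \<Longrightarrow> i \<in> idx m \<Longrightarrow> v n i = v (n - 1) i + \<epsilon> * F_trunc m (v n) i"
    unfolding is_euler_solution_trunc_def by blast+
  have eq: "null_expansion m (v n) = (T (idx m) ^^ n) (null_expansion m y)" for n
  proof (induction n)
    case 0
    then show ?case using v by simp
  next
    case (Suc n)
    have "T (idx m) (null_expansion m (v n)) = null_expansion m (v (Suc n))"
    proof (rule T_eqI)
      show "norm (null_expansion m (v (Suc n))) \<le> r_star"
        using null_expansion_phase[OF ball] by (simp add: phase_def)
      have "v (Suc n) i = v n i + \<epsilon> * F_trunc m (v (Suc n)) i" if "i \<in> idx m" for i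
        using that by (metis diff_Suc_1 le_add1 plus_1_eq_Suc step)
      then have "null_expansion m (v (Suc n))
          = null_expansion m (v n) + \<epsilon> *\<^sub>R null_expansion m (F_trunc m (v (Suc n)))"
        by (intro ell2_eqI) (auto split: if_splits)
      then show "null_expansion m (v (Suc n))
          = null_expansion m (v n) + \<epsilon> *\<^sub>R G (idx m) (null_expansion m (v (Suc n)))"
        by (simp add: null_expansion_F_trunc)
    qed (rule null_expansion_phase[OF ball])
    with Suc.IH show ?case by simp
  qed
  have "v n = restrict (ell2_nth ((T (idx m) ^^ n) (null_expansion m y))) (idx m)" for n
    using restrict_null_expansion[of "v n" m] ball[of n] by (simp add: eq trunc_ball_def)
  then show "v = (\<lambda>n. restrict (ell2_nth ((T (idx m) ^^ n) (null_expansion m y))) (idx m))"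
    by blast
next
  let ?x = "\<lambda>n. (T (idx m) ^^ n) (null_expansion m y)"
  assume v: "v = (\<lambda>n. restrict (ell2_nth (?x n)) (idx m))"
  have ph: "?x n \<in> phase (idx m)" for n
    by (intro funpow_T_phase null_expansion_phase assms)
  have x: "null_expansion m (v n) = ?x n" for n
    using ph[of n] by (simp add: v null_expansion_restrict phase_def)
  have "v n i = v (n - 1) i + \<epsilon> * F_trunc m (v n) i" if "n \<ge> 1" "i \<in> idx m" for n i
  proof -
    have "?x n = T (idx m) (?x (n - 1))" using that by (cases n) auto
    then have "?x n = ?x (n - 1) + \<epsilon> *\<^sub>R null_expansion m (F_trunc m (v n))"
      using T_step(2)[OF ph[of "n - 1"]] by (simp add: null_expansion_F_trunc x)
    from arg_cong[OF this, of "\<lambda>u. ell2_nth u i"] show ?thesis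
      using that(2) by (simp add: x[symmetric])
  qed
  moreover have "v 0 = y"
    using restrict_null_expansion[of y m] assms by (simp add: v trunc_ball_def)
  ultimately show "is_euler_solution_trunc \<epsilon> m y v"
    using restrict_phase[OF ph] unfolding is_euler_solution_trunc_def v by blast
qed

lemma null_expansion_S_trunc:
  assumes "y \<in> trunc_ball m r_star"
  shows "null_expansion m (S_trunc \<epsilon> m n y) = (T (idx m) ^^ n) (null_expansion m y)"
  using funpow_T_phase[OF null_expansion_phase[OF assms], of n]
  by (simp add: S_trunc_def is_euler_solution_trunc_iff[OF assms] null_expansion_restrict phase_def)

lemma Metric_space_trunc: "Metric_space (trunc_space m) (\<lambda>z w. L2_set (\<lambda>i. z i - w i) (idx m))"
proof
  fix x y z :: "int \<Rightarrow> real"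
  show "L2_set (\<lambda>i. x i - y i) (idx m) = L2_set (\<lambda>i. y i - x i) (idx m)"
    by (simp add: L2_set_def power2_commute)
  show "L2_set (\<lambda>i. x i - z i) (idx m)
      \<le> L2_set (\<lambda>i. x i - y i) (idx m) + L2_set (\<lambda>i. y i - z i) (idx m)"
    using L2_set_triangle_ineq[of "\<lambda>i. x i - y i" "\<lambda>i. y i - z i" "idx m"] by simp
  assume "x \<in> trunc_space m" "y \<in> trunc_space m"
  then show "L2_set (\<lambda>i. x i - y i) (idx m) = 0 \<longleftrightarrow> x = y"
    by (auto simp: L2_set_eq_0_iff trunc_space_def intro: PiE_ext)
qed simp

lemma attractor_trunc_approx:
  assumes "z \<in> attractor_trunc \<epsilon> m" and "e > 0"
  shows "\<exists>n\<ge>N. \<exists>y\<in>phase (idx m). dist (null_expansion m z) ((T (idx m) ^^ n) y) < e"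
proof -
  interpret Metric_space "trunc_space m" "\<lambda>z w. L2_set (\<lambda>i. z i - w i) (idx m)"
    by (rule Metric_space_trunc)
  \<comment> \<open>\<open>Suc N\<close>, because the intersection defining
    \<open>attractor_trunc\<close> starts at 1.\<close>
  have "z \<in> trunc_topology m closure_of (\<Union>n\<in>{Suc N..}. S_trunc \<epsilon> m n ` trunc_ball m r_star)"
    using assms(1) by (simp add: attractor_trunc_def)
  then obtain n y where n: "n \<ge> Suc N" "y \<in> trunc_ball m r_star"
    and d: "L2_set (\<lambda>i. z i - S_trunc \<epsilon> m n y i) (idx m) < e"
    using assms(2) unfolding trunc_topology_def metric_closure_of by fastforce
  have "null_expansion m z - null_expansion m (S_trunc \<epsilon> m n y)
      = null_expansion m (\<lambda>i. z i - S_trunc \<epsilon> m n y i)"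
    by (rule ell2_eqI) simp
  then have "dist (null_expansion m z) ((T (idx m) ^^ n) (null_expansion m y)) < e"
    using d by (simp add: dist_norm norm_null_expansion null_expansion_S_trunc[OF n(2), symmetric])
  then show ?thesis
    using n null_expansion_phase by (metis Suc_leD)
qed

subsection \<open>Comparison of the two schemes\<close>

text \<open>Transport and cubic term agree for \<open>v\<close> supported in the range, so only the
  Laplacians and the force differ. The part of \<open>v\<close> in \<open>J\<close> has all its
  neighbours inside the range and contributes nothing; the rest meets two operators of norm at most
  4. Since subtraction is natural, \<open>m > 0\<close> ensures that \<open>idx (m - 1)\<close> is
  really smaller.\<close>

lemma norm_F_diff_G_le:
  assumes "restr (idx m) v = v" and "J \<subseteq> idx (m - 1)" and "m > 0"
  shows "norm (F v - G (idx m) v) \<le> 8 * \<nu> * norm (v - restr J v) + norm (f - restr (idx m) f)"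
proof -
  let ?Lap = "\<lambda>I u. restr I (Dplus (restr I (Dminus (restr I u))))"
  define a b where "a = restr J v" and "b = v - restr J v"
  have v: "v = a + b" by (simp add: a_def b_def)
  have *: "i + 1 \<in> idx m" "i - 1 \<in> idx m" "i \<in> idx m" if "i \<in> J" for i
    using assms(2,3) that by (auto simp: idx_def subset_iff)
  have "i \<in> idx m" if "i + 1 \<in> J" for i using *(2)[OF that] by simp
  moreover have "i \<in> idx m" if "i - 1 \<in> J" for i using *(1)[OF that] by simp
  ultimately have La: "?Lap UNIV a = ?Lap (idx m) a"
    by (intro ell2_eqI) (use * in \<open>auto simp: a_def\<close>)
  have lin: "?Lap I v = ?Lap I a + ?Lap I b" for I
    unfolding v by (rule ell2_eqI) simp
  have vD: "restr (idx m) (v * Dminus v) = v * Dminus v"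
    by (rule ell2_eqI) (use assms(1) in \<open>metis ell2_nth_simps(6) mult_zero_left restr_nth\<close>)
  have "F v - G (idx m) v = \<nu> *\<^sub>R (?Lap UNIV b - ?Lap (idx m) b) + (f - restr (idx m) f)"
    unfolding G_UNIV[symmetric] G_def lin La using assms(1)
    by (simp add: vD algebra_simps)
  also have "norm \<dots> \<le> \<nu> * norm (?Lap UNIV b - ?Lap (idx m) b) + norm (f - restr (idx m) f)"
    using \<nu>_pos norm_triangle_ineq[of "\<nu> *\<^sub>R (?Lap UNIV b - ?Lap (idx m) b)" "f - restr (idx m) f"]
    by simp
  also have "norm (?Lap UNIV b - ?Lap (idx m) b) \<le> 4 * norm b + 4 * norm b"
    by (meson add_mono norm_restr_Lap_le norm_triangle_ineq4 order_trans)
  finally show ?thesis using \<nu>_pos by (simp add: b_def mult_ac)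
qed

text \<open>A truncated step is an exact step from a perturbed datum: the consistency error
  \<open>?p\<close> is moved into the initial value. Lipschitz dependence gives the recursion e' <=
  C (e + d) with C >= 1, hence the factor n C^n.\<close>

lemma truncation_error:
  assumes "w \<in> phase (idx m)" and "J \<subseteq> idx (m - 1)" and "m > 0"
    and tail: "\<And>j. norm ((T (idx m) ^^ j) w - restr J ((T (idx m) ^^ j) w)) \<le> \<eta>"
  shows "norm ((T (idx m) ^^ n) w - (T UNIV ^^ n) w)
    \<le> real n * step_const ^ n * (\<epsilon> * (8 * \<nu> * \<eta> + norm (f - restr (idx m) f)))"
    (is "_ \<le> _ * ?d")
proof (induction n)
  case (Suc n)
  let ?x = "\<lambda>n. (T (idx m) ^^ n) w" and ?y = "\<lambda>n. (T UNIV ^^ n) w"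
  let ?p = "\<epsilon> *\<^sub>R (G (idx m) (?x (Suc n)) - F (?x (Suc n)))"
  have x: "?x n \<in> phase (idx m)" "?x (Suc n) \<in> phase (idx m)" for n
    by (rule funpow_T_phase[OF assms(1)])+
  have y: "?y n \<in> phase UNIV"
    by (rule funpow_T_phase) (use assms(1) in \<open>simp add: phase_def\<close>)
  have "norm ?p \<le> \<epsilon> * (8 * \<nu> * norm (?x (Suc n) - restr J (?x (Suc n))) + norm (f - restr (idx m) f))"
    using norm_F_diff_G_le[OF _ assms(2,3), of "?x (Suc n)"] x(2)[of n] \<epsilon>_pos
    by (simp add: norm_minus_commute phase_def)
  also have "\<dots> \<le> ?d"
    using tail[of "Suc n"] \<epsilon>_pos \<nu>_pos by (intro mult_left_mono add_right_mono) auto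
  finally have p: "norm ?p \<le> ?d" .
  then have d: "0 \<le> ?d" by (rule order_trans[OF norm_ge_zero])
  have "norm (?x (Suc n) - ?y (Suc n)) \<le> step_const * norm ((?x n + ?p) - ?y n)"
  proof (rule euler_step_lipschitz)
    have "?x (Suc n) = ?x n + \<epsilon> *\<^sub>R G (idx m) (?x (Suc n))"
      unfolding funpow.simps o_apply by (rule T_step(2)[OF x(1)])
    then show "?x (Suc n) = (?x n + ?p) + \<epsilon> *\<^sub>R G UNIV (?x (Suc n))"
      unfolding G_UNIV scaleR_diff_right by simp
    show "?y (Suc n) = ?y n + \<epsilon> *\<^sub>R G UNIV (?y (Suc n))"
      unfolding funpow.simps o_apply by (rule T_step(2)[OF y])
    show "norm (?x (Suc n)) \<le> r_star + 1" using x(2)[of n] by (simp add: phase_def)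
    show "norm (?y (Suc n)) \<le> r_star + 1" using T_step(1)[OF y] by simp
  qed
  also have "\<dots> \<le> step_const * (real n * step_const ^ n * ?d + step_const ^ n * ?d)"
  proof (rule mult_left_mono)
    have "norm ((?x n + ?p) - ?y n) \<le> norm (?x n - ?y n) + norm ?p"
      using norm_triangle_ineq[of "?x n - ?y n" ?p] by (simp add: algebra_simps)
    moreover have "?d \<le> step_const ^ n * ?d"
      using mult_right_mono[OF one_le_power[OF step_const_ge_1] d] by simp
    ultimately show "norm ((?x n + ?p) - ?y n) \<le> real n * step_const ^ n * ?d + step_const ^ n * ?d"
      using Suc.IH p by linarith
  qed (use step_const_ge_1 in simp)
  also have "\<dots> = real (Suc n) * step_const ^ Suc n * ?d"
    by (simp only: of_nat_Suc power_Suc distrib_left distrib_right mult_1 mult_ac)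
  finally show ?case .
qed simp

lemma attractor_trunc_upper_semicontinuous:
  "(\<lambda>m. hausdorff_semidist (null_expansion m ` attractor_trunc \<epsilon> m) (attractor \<epsilon>)) \<longlonglongrightarrow> 0"
proof (rule tendsto_hausdorff_semidist_zeroI)
  fix e :: real assume e: "e > 0"
  have "(\<lambda>n. hausdorff_semidist (S \<epsilon> n ` cball 0 r_star) (attractor \<epsilon>)) \<longlonglongrightarrow> 0"
    using is_attractor_attractor by (simp add: is_attractor_def)
  then have "\<forall>\<^sub>F n in sequentially.
      hausdorff_semidist (S \<epsilon> n ` cball 0 r_star) (attractor \<epsilon>) < ennreal (e / 3)"
    using e by (intro order_tendstoD(2)) auto
  then obtain n where n:
    "hausdorff_semidist (S \<epsilon> n ` cball 0 r_star) (attractor \<epsilon>) < ennreal (e / 3)"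
    by (auto simp: eventually_sequentially)
  define q where "q = real n * step_const ^ n * \<epsilon>"
  have q: "0 \<le> q" using \<epsilon>_pos step_const_ge_1 by (simp add: q_def)
  \<comment> \<open>\<open>q\<close> vanishes for n = 0, hence the \<open>1 +\<close>. The budget is
    e/3 for the closure, e/3 for the truncation (e/6 from tails, e/6 from the force) and e/3 for the
    attraction.\<close>
  define \<eta> where "\<eta> = e / 6 / (1 + q * (8 * \<nu>))"
  have pos: "1 + q * (8 * \<nu>) > 0" using q \<nu>_pos by (simp add: add_pos_nonneg)
  then have \<eta>: "\<eta> > 0" using e unfolding \<eta>_def by (intro divide_pos_pos) auto
  have "q * (8 * \<nu>) * \<eta> \<le> (1 + q * (8 * \<nu>)) * \<eta>"
    using \<eta> by (intro mult_right_mono) auto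
  also have "\<dots> = e / 6" unfolding \<eta>_def using pos
    by (subst times_divide_eq_right, intro nonzero_mult_div_cancel_left) simp
  finally have q\<eta>: "q * (8 * \<nu>) * \<eta> \<le> e / 6" .
  obtain K N where tail: "\<And>I y n. y \<in> phase I \<Longrightarrow> n \<ge> N \<Longrightarrow>
      norm ((T I ^^ n) y - restr (idx K) ((T I ^^ n) y)) \<le> \<eta>"
    using uniform_tail[OF \<eta>] by blast
  have "(\<lambda>m. q * norm (f - restr (idx m) f)) \<longlonglongrightarrow> q * 0"
    by (intro tendsto_intros tendsto_norm_diff_restr)
  then have "\<forall>\<^sub>F m in sequentially. q * norm (f - restr (idx m) f) < e / 6"
    using e by (intro order_tendstoD(2)) auto
  then show "\<forall>\<^sub>F m in sequentially.
      \<forall>a\<in>null_expansion m ` attractor_trunc \<epsilon> m. \<exists>b\<in>attractor \<epsilon>. dist a b \<le> e"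
    \<comment> \<open>\<open>Suc K\<close> leaves the site between \<open>idx K\<close> and the
      boundary that \<open>norm_F_diff_G_le\<close> needs.\<close>
    using eventually_ge_at_top[of "Suc K"]
  proof eventually_elim
    case (elim m)
    have "\<exists>b\<in>attractor \<epsilon>. dist (null_expansion m z) b \<le> e" if zA: "z \<in> attractor_trunc \<epsilon> m" for z
    proof -
      obtain n' y where n': "n' \<ge> N + n" and y: "y \<in> phase (idx m)"
        and z: "dist (null_expansion m z) ((T (idx m) ^^ n') y) < e / 3"
        using attractor_trunc_approx[OF zA, of "e / 3" "N + n"] e by auto
      \<comment> \<open>The comparison starts at time \<open>n' - n\<close>, which is at least
        \<open>N\<close>, so the tails are small along the whole orbit of \<open>w\<close>.\<close>
      define w where "w = (T (idx m) ^^ (n' - n)) y"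
      have w: "w \<in> phase (idx m)" unfolding w_def using y by (rule funpow_T_phase)
      have Tw: "(T (idx m) ^^ j) w = (T (idx m) ^^ (j + (n' - n))) y" for j
        by (simp add: w_def funpow_add)
      have "norm ((T (idx m) ^^ n) w - (T UNIV ^^ n) w)
          \<le> real n * step_const ^ n * (\<epsilon> * (8 * \<nu> * \<eta> + norm (f - restr (idx m) f)))"
      proof (rule truncation_error[OF w])
        show "idx K \<subseteq> idx (m - 1)" using elim(2) by (intro idx_mono) simp
        show "norm ((T (idx m) ^^ j) w - restr (idx K) ((T (idx m) ^^ j) w)) \<le> \<eta>" for j
          unfolding Tw using n' by (intro tail[OF y]) simp
      qed (use elim(2) in simp)
      also have "\<dots> = q * (8 * \<nu>) * \<eta> + q * norm (f - restr (idx m) f)"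
        by (simp add: q_def algebra_simps)
      also have "\<dots> \<le> e / 3" using q\<eta> elim(1) by simp
      finally have 2: "dist ((T (idx m) ^^ n') y) ((T UNIV ^^ n) w) \<le> e / 3"
        using n' by (simp add: Tw dist_norm)
      have "w \<in> cball 0 r_star" using w by (simp add: phase_def)
      then have "(T UNIV ^^ n) w \<in> S \<epsilon> n ` cball 0 r_star"
        using S_eq[of w n] by (metis image_eqI)
      from hausdorff_semidist_lessD[OF n this] obtain b
        where b: "b \<in> attractor \<epsilon>" "dist ((T UNIV ^^ n) w) b < e / 3" by blast
      have "dist (null_expansion m z) b \<le> dist (null_expansion m z) ((T (idx m) ^^ n') y)
          + (dist ((T (idx m) ^^ n') y) ((T UNIV ^^ n) w) + dist ((T UNIV ^^ n) w) b)"
        by (meson add_left_mono dist_triangle order_trans)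
      also have "\<dots> \<le> e" using z 2 b(2) by linarith
      finally show ?thesis using b(1) by blast
    qed
    then show ?case by blast
  qed
qed

end

theorem theorem4p2:
  fixes \<alpha> \<beta> \<nu> \<gamma> lam \<epsilon> :: real and f :: ell2
  assumes "\<alpha> > 0" and "\<beta> > 0" and "\<nu> > 0" and "lam > 0" and "0 < \<gamma>" and "\<gamma> < 1"
    and "lam > lattice_system.lam_star \<alpha> \<beta> \<nu> \<gamma>"
    and "0 < \<epsilon>" and "\<epsilon> \<le> lattice_system.eps_star \<alpha> \<beta> \<nu> \<gamma> lam f"
  shows "(\<lambda>m. hausdorff_semidist
             (null_expansion m ` lattice_system.attractor_trunc \<alpha> \<beta> \<nu> \<gamma> lam f \<epsilon> m)
             (lattice_system.attractor \<alpha> \<beta> \<nu> \<gamma> lam f \<epsilon>)) \<longlonglongrightarrow> 0"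
proof -
  interpret euler_scheme \<alpha> \<beta> \<nu> \<gamma> lam f \<epsilon>
    by unfold_locales (use assms in auto)
  show ?thesis by (rule attractor_trunc_upper_semicontinuous)
qed

end
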